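(* Let $k>2$ be an integer. There exist infinitely many irreducible polynomials $f$ over $\mathbb{Q}$ such that the splitting field $\mathbb{Q}_f$ of $f$ over $\mathbb{Q}$ has two minimal generating sets of different cardinalities: one of cardinality $2$ and another of cardinality $k$. In fact, one can obtain infinitely many such polynomials of the same degree as well.
   Context: For an irreducible polynomial $f$ over $\mathbb{Q}$ with set of roots $R\subset\bar{\mathbb{Q}}$ and splitting field $\mathbb{Q}_f$, a set $B\subset R$ is a minimal generating set of the splitting field of $f$ over $\mathbb{Q}$ if $\mathbb{Q}(B)=\mathbb{Q}_f$ and $\mathbb{Q}(A)\neq\mathbb{Q}_f$ for every $A\subsetneq B$. *)

theory Defs
  imports Complex_Main "HOL-Computational_Algebra.Computational_Algebra"
begin

definition is_subfield :: "'a::field set \<Rightarrow> bool" where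
  "is_subfield K \<longleftrightarrow> 0 \<in> K \<and> 1 \<in> K \<and>
     (\<forall>x\<in>K. \<forall>y\<in>K. x + y \<in> K \<and> x * y \<in> K) \<and> (\<forall>x\<in>K. - x \<in> K \<and> inverse x \<in> K)"

text \<open>
  The algebraic closure of the rationals is taken inside the complex numbers: all complex
  roots of a nonzero rational polynomial are algebraic and the polynomial splits over them.
\<close>

definition roots_of :: "rat poly \<Rightarrow> complex set" where
  "roots_of f = {z. poly (map_poly of_rat f) z = 0}"

definition rat_adjoin :: "complex set \<Rightarrow> complex set" where
  "rat_adjoin B = (\<lambda>K. is_subfield K \<and> \<rat> \<subseteq> K) hull B"

definition splitting_field :: "rat poly \<Rightarrow> complex set" where
  "splitting_field f = rat_adjoin (roots_of f)"

definition minimal_generating_set :: "rat poly \<Rightarrow> complex set \<Rightarrow> bool" where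
  "minimal_generating_set f B \<longleftrightarrow>
     B \<subseteq> roots_of f \<and> rat_adjoin B = splitting_field f \<and>
     (\<forall>A. A \<subset> B \<longrightarrow> rat_adjoin A \<noteq> splitting_field f)"

text \<open>
  Polynomials are counted up to nonzero scalar factors, hence the normalisation to monic ones;
  without it, the multiples of a single polynomial would already form an infinite family.
\<close>

definition mingen_polys :: "nat \<Rightarrow> rat poly set" where
  "mingen_polys k = {f. irreducible f \<and> lead_coeff f = 1 \<and>
     (\<exists>B C. minimal_generating_set f B \<and> card B = 2 \<and>
            minimal_generating_set f C \<and> card C = k)}"

lemma is_subfield_rat_adjoin: "is_subfield (rat_adjoin B)"
  by (auto simp: rat_adjoin_def hull_def is_subfield_def)

end

theory Submission
  imports Defs "HOL-Library.FuncSet" "HOL-Number_Theory.Cong"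
begin

text \<open>
  Take \<open>k\<close> quartics $(y^2 - t_i)^2 = t_i$ with roots $\pm a_i, \pm b_i$, where $a_i^2 = t_i + \sqrt{t_i}$
  and $b_i^2 = t_i - \sqrt{t_i}$. If the integers $t_i$ and $t_i - 1$ are independent modulo squares, then
  the $a_i$ and $b_i$ are independent modulo squares over $F = \mathbb{Q}(\sqrt{t_1}, \dots, \sqrt{t_k})$,
  so that the Galois groups of the quartics act independently of each other and all sums with one
  root from each quartic are conjugate: they are the roots of an irreducible polynomial \<open>f\<close>. Such a
  sum generates its own summands, so sums of $a_i$'s and $b_i$'s generate the splitting field if
  and only if every $a_i$ and every $b_i$ occurs in one of them. Both $\{\sum a_i, \sum b_i\}$ and
  the set of the \<open>k\<close> sums obtained from $\sum a_i$ by replacing one $a_j$ by $b_j$ are minimal with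
  this property. The translates of \<open>f\<close> by rational numbers give infinitely many polynomials of the
  same degree.
\<close>

section \<open>Quadratic extensions of subfields\<close>

text \<open>Stated for any field type. In characteristic 0 every subfield contains the rationals, so
  over the complex numbers this is \<open>rat_adjoin\<close>.\<close>

definition gen_field :: "'a::field set \<Rightarrow> 'a set" where
  "gen_field A = is_subfield hull A"

lemma is_subfield_gen_field [simp, intro]: "is_subfield (gen_field A)"
  by (auto simp: gen_field_def hull_def is_subfield_def)

lemma gen_field_superset: "A \<subseteq> gen_field A"
  by (simp add: gen_field_def hull_subset)

lemma gen_field_inc: "x \<in> A \<Longrightarrow> x \<in> gen_field A"
  by (simp add: gen_field_def hull_inc)

lemma gen_field_minimal: "A \<subseteq> K \<Longrightarrow> is_subfield K \<Longrightarrow> gen_field A \<subseteq> K"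
  by (simp add: gen_field_def hull_minimal)

lemma gen_field_mono: "A \<subseteq> B \<Longrightarrow> gen_field A \<subseteq> gen_field B"
  by (simp add: gen_field_def hull_mono)

lemma gen_field_insert_absorb: "x \<in> gen_field A \<Longrightarrow> gen_field (insert x A) = gen_field A"
  unfolding gen_field_def by (rule hull_redundant)

section \<open>Closure properties of subfields\<close>

lemma
  assumes "is_subfield K"
  shows subfield_0: "0 \<in> K" and subfield_1: "1 \<in> K"
    and subfield_add: "x \<in> K \<Longrightarrow> y \<in> K \<Longrightarrow> x + y \<in> K"
    and subfield_mult: "x \<in> K \<Longrightarrow> y \<in> K \<Longrightarrow> x * y \<in> K"
    and subfield_uminus: "x \<in> K \<Longrightarrow> - x \<in> K"
    and subfield_inverse: "x \<in> K \<Longrightarrow> inverse x \<in> K"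
  using assms by (auto simp: is_subfield_def)

lemma subfield_diff: "is_subfield K \<Longrightarrow> x \<in> K \<Longrightarrow> y \<in> K \<Longrightarrow> x - y \<in> K"
  using subfield_add[of K x "- y"] subfield_uminus[of K y] by simp

lemma subfield_divide: "is_subfield K \<Longrightarrow> x \<in> K \<Longrightarrow> y \<in> K \<Longrightarrow> x / y \<in> K"
  using subfield_mult[of K x "inverse y"] subfield_inverse[of K y] by (simp add: divide_inverse)

lemma subfield_power: "is_subfield K \<Longrightarrow> x \<in> K \<Longrightarrow> x ^ n \<in> K"
  by (induction n) (auto intro: subfield_1 subfield_mult)

lemma subfield_of_nat: "is_subfield K \<Longrightarrow> of_nat n \<in> K"
  by (induction n) (auto intro: subfield_0 subfield_1 subfield_add)

lemma subfield_numeral: "is_subfield K \<Longrightarrow> numeral n \<in> K"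
  using subfield_of_nat[of K "numeral n"] by simp

lemma subfield_Rats: "is_subfield K \<Longrightarrow> \<rat> \<subseteq> (K :: 'a::field_char_0 set)"
proof
  fix x :: 'a assume K: "is_subfield K" and "x \<in> \<rat>"
  then obtain a b where x: "x = of_int a / of_int b"
    by (metis Rats_cases')
  have "of_int c \<in> K" for c
    by (cases c rule: int_cases2) (auto intro: K subfield_of_nat subfield_uminus)
  then show "x \<in> K" unfolding x using K by (intro subfield_divide) auto
qed

lemma subfield_sum: "is_subfield K \<Longrightarrow> (\<And>i. i \<in> I \<Longrightarrow> f i \<in> K) \<Longrightarrow> sum f I \<in> K"
  by (induction I rule: infinite_finite_induct) (auto intro: subfield_0 subfield_add)

lemma subfield_prod: "is_subfield K \<Longrightarrow> (\<And>i. i \<in> I \<Longrightarrow> f i \<in> K) \<Longrightarrow> prod f I \<in> K"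
  by (induction I rule: infinite_finite_induct) (auto intro: subfield_1 subfield_mult)

lemmas subfield_closed = subfield_0 subfield_1 subfield_add subfield_mult subfield_uminus
  subfield_inverse subfield_diff subfield_divide subfield_power subfield_of_nat subfield_numeral
  subfield_sum subfield_prod

lemma is_subfield_Rats: "is_subfield (\<rat> :: 'a::field_char_0 set)"
  by (auto simp: is_subfield_def)

lemma gen_field_empty: "gen_field {} = (\<rat> :: 'a::field_char_0 set)"
  by (simp add: gen_field_minimal is_subfield_Rats subfield_Rats subset_antisym)

lemma rat_adjoin_eq_gen_field: "rat_adjoin B = gen_field B"
proof -
  have "(\<lambda>K. is_subfield K \<and> \<rat> \<subseteq> K) = (is_subfield :: complex set \<Rightarrow> bool)"
    using subfield_Rats by blast
  then show ?thesis by (simp add: rat_adjoin_def gen_field_def)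
qed

section \<open>Adjoining square roots\<close>

text \<open>If \<open>s\<close> is already present, both sides are \<open>gen_field A\<close>.
  Otherwise the right-hand side is itself a field: products reduce because the square of
  \<open>s\<close> lies below, and inverses come from rationalising the denominator.\<close>

lemma gen_field_insert_quadratic:
  fixes s :: "'a::field"
  assumes sq: "s\<^sup>2 \<in> gen_field A"
  shows "gen_field (insert s A) = {x + y * s |x y. x \<in> gen_field A \<and> y \<in> gen_field A}"
    (is "_ = ?E")
proof (cases "s \<in> gen_field A")
  case True
  have "x \<in> ?E" if "x \<in> gen_field A" for x
    using that by (intro CollectI exI[of _ x] exI[of _ 0]) (auto intro: subfield_0)
  moreover have "?E \<subseteq> gen_field A" using True by (auto intro!: subfield_add subfield_mult)
  ultimately show ?thesis using gen_field_insert_absorb[OF True] by blast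
next
  case False
  let ?K = "gen_field A"
  have K: "is_subfield ?K" by simp
  have I: "x + y * s \<in> ?E" if "x \<in> ?K" "y \<in> ?K" for x y
    using that by blast
  have sub: "?K \<subseteq> ?E"
    using I[OF _ subfield_0[OF K]] by auto
  have "is_subfield ?E"
    unfolding is_subfield_def
  proof (intro conjI ballI)
    show "0 \<in> ?E" "1 \<in> ?E" using sub K subfield_0 subfield_1 by blast+
  next
    fix p q assume "p \<in> ?E" "q \<in> ?E"
    then obtain x y x' y' where xy: "x \<in> ?K" "y \<in> ?K" "x' \<in> ?K" "y' \<in> ?K"
      and p: "p = x + y * s" and q: "q = x' + y' * s" by blast
    have "p + q = (x + x') + (y + y') * s" by (simp add: p q algebra_simps)
    then show "p + q \<in> ?E" using I[of "x + x'" "y + y'"] xy by (auto intro: subfield_closed)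
    have "p * q = (x * x' + y * y' * s\<^sup>2) + (x * y' + y * x') * s"
      by (simp add: p q algebra_simps power2_eq_square)
    then show "p * q \<in> ?E"
      using I[of "x * x' + y * y' * s\<^sup>2" "x * y' + y * x'"] xy sq by (auto intro!: subfield_closed)
  next
    fix p assume "p \<in> ?E"
    then obtain x y where xy: "x \<in> ?K" "y \<in> ?K" and p: "p = x + y * s" by blast
    have "- p = (- x) + (- y) * s" by (simp add: p)
    then show "- p \<in> ?E" using I[of "- x" "- y"] xy by (auto intro: subfield_closed)
    show "inverse p \<in> ?E"
    proof (cases "y = 0")
      case True
      then have "inverse p \<in> ?K" using p xy by (auto intro: subfield_closed)
      then show ?thesis using sub by blast
    next
      case y: False
      \<comment> \<open>If one of these factors vanished, \<open>s\<close> would be a quotient of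
        elements of \<open>?K\<close>.\<close>
      have ne: "x + y * s \<noteq> 0" "x - y * s \<noteq> 0"
      proof -
        have "s = - x / y" if "x + y * s = 0"
        proof -
          have "- x = y * s" using that by (simp add: neg_eq_iff_add_eq_0)
          then show ?thesis using y by simp
        qed
        then show "x + y * s \<noteq> 0"
          using False subfield_divide[OF K subfield_uminus[OF K xy(1)] xy(2)] by auto
        have "s = x / y" if "x - y * s = 0"
        proof -
          have "x = y * s" using that by simp
          then show ?thesis using y by simp
        qed
        then show "x - y * s \<noteq> 0" using False subfield_divide[OF K xy(1,2)] by auto
      qed
      \<comment> \<open>The norm of \<open>p\<close>, a nonzero element of
        \<open>?K\<close>.\<close>
      define d where "d = x\<^sup>2 - y\<^sup>2 * s\<^sup>2"
      have d: "d = (x + y * s) * (x - y * s)"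
        by (simp add: d_def algebra_simps power2_eq_square)
      have "inverse p = (x - y * s) / d" using ne by (simp add: p d divide_inverse)
      then have "inverse p = x / d + (- y / d) * s" by (simp add: diff_divide_distrib)
      moreover have "d \<in> ?K" unfolding d_def using xy sq by (auto intro!: subfield_closed)
      ultimately show ?thesis using I[of "x / d" "- y / d"] xy by (auto intro!: subfield_closed)
    qed
  qed
  moreover have "insert s A \<subseteq> ?E"
    using sub gen_field_superset[of A] I[of 0 1] K by (auto intro: subfield_closed)
  ultimately have "gen_field (insert s A) \<subseteq> ?E" by (simp add: gen_field_minimal)
  moreover have "?E \<subseteq> gen_field (insert s A)"
    using gen_field_mono[of A "insert s A"] gen_field_inc[of s "insert s A"]
    by (auto intro!: subfield_add subfield_mult)
  ultimately show ?thesis by blast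
qed

text \<open>Kummer theory in exponent 2, with the square roots themselves in place of the radicands.\<close>

lemma quadratic_kummer:
  fixes w :: "'i \<Rightarrow> 'a::field_char_0"
  assumes "finite I" "\<And>i. i \<in> I \<Longrightarrow> (w i)\<^sup>2 \<in> gen_field A"
    and "s \<in> gen_field (A \<union> w ` I)" "s\<^sup>2 \<in> gen_field A"
  shows "\<exists>J\<subseteq>I. s * prod w J \<in> gen_field A"
  using assms
proof (induction I arbitrary: s rule: finite_induct)
  case empty
  then show ?case by auto
next
  case (insert i I)
  let ?E = "gen_field (A \<union> w ` I)"
  have AE: "gen_field A \<subseteq> ?E" by (intro gen_field_mono) auto
  have wi: "(w i)\<^sup>2 \<in> ?E" using insert.prems(1)[of i] AE by auto
  show ?case
  proof (cases "s \<in> ?E")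
    case True
    then obtain J where "J \<subseteq> I" "s * prod w J \<in> gen_field A"
      using insert.IH[of s] insert.prems by auto
    then show ?thesis by blast
  next
    case False
    obtain x y where xy: "x \<in> ?E" "y \<in> ?E" "s = x + y * w i"
      using insert.prems(2) gen_field_insert_quadratic[OF wi] by auto
    have nw: "w i \<notin> ?E" using False xy by (auto intro: subfield_closed)
    have s2: "s\<^sup>2 \<in> ?E" using insert.prems(3) AE by blast
    \<comment> \<open>Squaring \<open>s = x + y * w i\<close> leaves the mixed term
      \<open>2 * x * y * w i\<close>; with \<open>x\<close> and \<open>y\<close> nonzero it could be
      solved for \<open>w i\<close>. So \<open>s\<close> is a multiple of \<open>w i\<close>, and
      the induction hypothesis applies to \<open>s * w i\<close>.\<close>
    have "x = 0"
    proof (rule ccontr)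
      assume "x \<noteq> 0"
      moreover have "y \<noteq> 0" using False xy by auto
      ultimately have "w i = (s\<^sup>2 - x\<^sup>2 - y\<^sup>2 * (w i)\<^sup>2) / (2 * x * y)"
        by (simp add: xy(3) field_simps power2_eq_square)
      moreover have "\<dots> \<in> ?E"
        using s2 wi xy(1,2)
        by (intro subfield_divide subfield_diff subfield_mult is_subfield_gen_field)
           (simp_all add: subfield_power subfield_numeral)
      ultimately show False using nw by simp
    qed
    then have "s * w i = y * (w i)\<^sup>2" using xy by (simp add: power2_eq_square)
    then have "s * w i \<in> ?E" using xy wi by (simp add: subfield_mult)
    moreover have "(s * w i)\<^sup>2 \<in> gen_field A"
      using insert.prems(1)[of i] insert.prems(3) by (auto simp: power_mult_distrib intro: subfield_mult)
    ultimately obtain J where J: "J \<subseteq> I" "s * w i * prod w J \<in> gen_field A"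
      using insert.IH[of "s * w i"] insert.prems by auto
    moreover have "finite J" "i \<notin> J" using J insert.hyps finite_subset by auto
    ultimately have "s * prod w (insert i J) \<in> gen_field A" by (simp add: mult.assoc)
    then show ?thesis using J by (intro exI[of _ "insert i J"]) auto
  qed
qed

section \<open>Field homomorphisms\<close>

text \<open>Total functions restricted to their values on \<open>K\<close>; the image may leave
  \<open>K\<close>. The condition at 1 excludes the zero map.\<close>

definition hom_on :: "'a::field set \<Rightarrow> ('a \<Rightarrow> 'a) \<Rightarrow> bool" where
  "hom_on K \<phi> \<longleftrightarrow> \<phi> 1 = 1 \<and> (\<forall>x\<in>K. \<forall>y\<in>K. \<phi> (x + y) = \<phi> x + \<phi> y \<and> \<phi> (x * y) = \<phi> x * \<phi> y)"

lemma hom_on_id: "hom_on K (\<lambda>x. x)"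
  by (simp add: hom_on_def)

lemma
  assumes "hom_on K \<phi>"
  shows hom_on_1: "\<phi> 1 = 1"
    and hom_on_add: "x \<in> K \<Longrightarrow> y \<in> K \<Longrightarrow> \<phi> (x + y) = \<phi> x + \<phi> y"
    and hom_on_mult: "x \<in> K \<Longrightarrow> y \<in> K \<Longrightarrow> \<phi> (x * y) = \<phi> x * \<phi> y"
  using assms by (auto simp: hom_on_def)

context
  fixes K :: "'a::field_char_0 set" and \<phi>
  assumes K: "is_subfield K" and hom: "hom_on K \<phi>"
begin

lemma hom_on_0: "\<phi> 0 = 0"
  using hom_on_add[OF hom, of 0 0] subfield_0[OF K] by simp

lemma hom_on_uminus: "x \<in> K \<Longrightarrow> \<phi> (- x) = - \<phi> x"
  using hom_on_add[OF hom, of x "- x"] subfield_uminus[OF K] hom_on_0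
  by (simp add: eq_neg_iff_add_eq_0 add.commute)

lemma hom_on_diff: "x \<in> K \<Longrightarrow> y \<in> K \<Longrightarrow> \<phi> (x - y) = \<phi> x - \<phi> y"
  using hom_on_add[OF hom, of x "- y"] hom_on_uminus[of y] subfield_uminus[OF K] by simp

lemma hom_on_power: "x \<in> K \<Longrightarrow> \<phi> (x ^ n) = \<phi> x ^ n"
  by (induction n) (auto simp: hom_on_1[OF hom] hom_on_mult[OF hom] subfield_power[OF K])

lemma hom_on_inverse: "x \<in> K \<Longrightarrow> \<phi> (inverse x) = inverse (\<phi> x)"
proof (cases "x = 0")
  case False
  assume "x \<in> K"
  then have "\<phi> x * \<phi> (inverse x) = \<phi> (x * inverse x)"
    using hom_on_mult[OF hom] subfield_inverse[OF K] by metis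
  then have "\<phi> x * \<phi> (inverse x) = 1" using False hom_on_1[OF hom] by simp
  then show ?thesis using inverse_unique by metis
qed (simp add: hom_on_0)

lemma hom_on_eq_0_iff: "x \<in> K \<Longrightarrow> \<phi> x = 0 \<longleftrightarrow> x = 0"
proof (cases "x = 0")
  case False
  assume "x \<in> K"
  then have "\<phi> x * \<phi> (inverse x) = \<phi> (x * inverse x)"
    using hom_on_mult[OF hom] subfield_inverse[OF K] by metis
  then show ?thesis using False hom_on_1[OF hom] by auto
qed (simp add: hom_on_0)

lemma hom_on_of_nat: "\<phi> (of_nat n) = of_nat n"
  by (induction n) (auto simp: hom_on_0 hom_on_1[OF hom] hom_on_add[OF hom] subfield_1[OF K] subfield_of_nat[OF K])

lemma hom_on_sum: "(\<And>i. i \<in> I \<Longrightarrow> f i \<in> K) \<Longrightarrow> \<phi> (sum f I) = (\<Sum>i\<in>I. \<phi> (f i))"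
  by (induction I rule: infinite_finite_induct)
     (auto simp: hom_on_0 hom_on_add[OF hom] subfield_sum[OF K])

lemma hom_on_prod: "(\<And>i. i \<in> I \<Longrightarrow> f i \<in> K) \<Longrightarrow> \<phi> (prod f I) = (\<Prod>i\<in>I. \<phi> (f i))"
  by (induction I rule: infinite_finite_induct)
     (auto simp: hom_on_1[OF hom] hom_on_mult[OF hom] subfield_prod[OF K])

lemma subfield_hom_fixed: "is_subfield {x \<in> K. \<phi> x = x}"
  unfolding is_subfield_def
  using K by (auto simp: hom_on_0 hom_on_1[OF hom] hom_on_add[OF hom] hom_on_mult[OF hom]
      hom_on_uminus hom_on_inverse intro: subfield_closed)

lemma hom_on_of_rat: "\<phi> (of_rat q) = of_rat q"
  using subfield_Rats[OF subfield_hom_fixed] Rats_of_rat by blast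

lemma hom_on_poly:
  assumes "x \<in> K"
  shows "\<phi> (poly (map_poly of_rat p) x) = poly (map_poly of_rat p) (\<phi> x)"
proof -
  have rat: "of_rat q \<in> K" for q using subfield_Rats[OF K] by auto
  have xn: "x ^ n \<in> K" for n using assms by (rule subfield_power[OF K])
  have "\<phi> (\<Sum>i\<le>n. of_rat (coeff p i) * x ^ i) = (\<Sum>i\<le>n. of_rat (coeff p i) * \<phi> x ^ i)" for n
    using rat xn assms
    by (simp add: hom_on_sum subfield_mult[OF K] hom_on_mult[OF hom] hom_on_of_rat hom_on_power)
  then show ?thesis by (simp add: poly_altdef coeff_map_poly degree_map_poly)
qed

text \<open>If \<open>\<phi>\<close> permutes \<open>R\<close>, this shows that it fixes the
  coefficients of the polynomial with root set \<open>R\<close>. Membership in \<open>K\<close> is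
  proved along with it, since the induction step applies \<open>\<phi>\<close> to differences and
  products of coefficients.\<close>

lemma hom_on_coeff_prod:
  assumes "finite R" "R \<subseteq> K"
  shows "coeff (\<Prod>r\<in>R. [:- r, 1:]) n \<in> K \<and>
    \<phi> (coeff (\<Prod>r\<in>R. [:- r, 1:]) n) = coeff (\<Prod>r\<in>R. [:- \<phi> r, 1:]) n"
  using assms
proof (induction R arbitrary: n rule: finite_induct)
  case empty
  then show ?case by (auto simp: hom_on_0 hom_on_1[OF hom] subfield_0[OF K] subfield_1[OF K])
next
  case (insert r R)
  let ?P = "\<Prod>r\<in>R. [:- r, 1:]" and ?Q = "\<Prod>r\<in>R. [:- \<phi> r, 1:]"
  have IH: "coeff ?P n \<in> K" "\<phi> (coeff ?P n) = coeff ?Q n" for n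
    using insert by auto
  have r: "r \<in> K" using insert by auto
  have c: "coeff ([:- a, 1:] * P) n = (case n of 0 \<Rightarrow> 0 | Suc m \<Rightarrow> coeff P m) - a * coeff P n"
    for a :: 'a and P n
    by (simp add: coeff_pCons split: nat.split)
  have "(case n of 0 \<Rightarrow> 0 | Suc m \<Rightarrow> coeff ?P m) \<in> K"
    "\<phi> (case n of 0 \<Rightarrow> 0 | Suc m \<Rightarrow> coeff ?P m) = (case n of 0 \<Rightarrow> 0 | Suc m \<Rightarrow> coeff ?Q m)"
    using IH by (auto simp: hom_on_0 subfield_0[OF K] split: nat.split)
  then show ?case
    unfolding prod.insert[OF insert.hyps] c
    using IH r by (simp add: hom_on_diff hom_on_mult[OF hom] subfield_diff[OF K] subfield_mult[OF K])
qed

end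

section \<open>Extending homomorphisms along square roots\<close>

text \<open>Coordinates with respect to \<open>1\<close> and \<open>s\<close> are unique because
  \<open>s\<close> is new, so \<open>x + y * s\<close> may be sent to
  \<open>\<phi> x + \<phi> y * s'\<close>; the relation between the squares of \<open>s\<close> and
  \<open>s'\<close> makes this multiplicative.\<close>

lemma hom_on_extend_quadratic:
  fixes s :: "'a::field_char_0"
  assumes hom: "hom_on (gen_field A) \<phi>" and sq: "s\<^sup>2 \<in> gen_field A"
    and s: "s \<notin> gen_field A" and s': "s'\<^sup>2 = \<phi> (s\<^sup>2)"
  obtains \<psi> where "hom_on (gen_field (insert s A)) \<psi>"
    and "\<And>x. x \<in> gen_field A \<Longrightarrow> \<psi> x = \<phi> x" and "\<psi> s = s'"
proof -
  let ?K = "gen_field A"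
  have K: "is_subfield ?K" by simp
  note hs = hom_on_0[OF K hom] hom_on_1[OF hom] hom_on_add[OF hom] hom_on_mult[OF hom]
  have uniq: "x = x' \<and> y = y'"
    if "x \<in> ?K" "y \<in> ?K" "x' \<in> ?K" "y' \<in> ?K" "x + y * s = x' + y' * s" for x y x' y'
  proof -
    have "y = y'"
    proof (rule ccontr)
      assume "y \<noteq> y'"
      then have "s = (x' - x) / (y - y')" using that(5) by (simp add: field_simps)
      then show False using s that by (auto intro: subfield_closed)
    qed
    then show ?thesis using that(5) by simp
  qed
  \<comment> \<open>\<open>P z p\<close> says that the pair \<open>p\<close> holds the coordinates
    of \<open>z\<close>; by \<open>uniq\<close> the choice made by \<open>SOME\<close> is
    forced.\<close>
  define P where "P z p \<longleftrightarrow> fst p \<in> ?K \<and> snd p \<in> ?K \<and> z = fst p + snd p * s" for z p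
  define \<psi> where "\<psi> z = (let p = (SOME p. P z p) in \<phi> (fst p) + \<phi> (snd p) * s')" for z
  have psi: "\<psi> (x + y * s) = \<phi> x + \<phi> y * s'" if "x \<in> ?K" "y \<in> ?K" for x y
  proof -
    have "P (x + y * s) (SOME p. P (x + y * s) p)"
      by (rule someI[of _ "(x, y)"]) (simp add: P_def that)
    then have "x = fst (SOME p. P (x + y * s) p) \<and> y = snd (SOME p. P (x + y * s) p)"
      using that unfolding P_def by (intro uniq) blast+
    then show ?thesis by (simp add: \<psi>_def Let_def)
  qed
  have agree: "\<psi> x = \<phi> x" if "x \<in> ?K" for x
    using psi[of x 0] that by (auto simp: hs subfield_closed)
  have "\<psi> s = s'" using psi[of 0 1] by (auto simp: hs subfield_closed)
  moreover have "hom_on (gen_field (insert s A)) \<psi>"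
    unfolding hom_on_def
  proof (intro conjI ballI)
    show "\<psi> 1 = 1" using agree[of 1] by (simp add: hs subfield_closed)
  next
    fix p q assume "p \<in> gen_field (insert s A)" "q \<in> gen_field (insert s A)"
    then obtain x y x' y' where xy: "x \<in> ?K" "y \<in> ?K" "x' \<in> ?K" "y' \<in> ?K"
      and p: "p = x + y * s" and q: "q = x' + y' * s"
      unfolding gen_field_insert_quadratic[OF sq] by blast
    have "p + q = (x + x') + (y + y') * s" by (simp add: p q algebra_simps)
    then show "\<psi> (p + q) = \<psi> p + \<psi> q"
      using psi[of "x + x'" "y + y'"] psi[of x y] psi[of x' y'] xy
      by (simp add: p q hs subfield_closed algebra_simps)
    have "p * q = (x * x' + y * y' * s\<^sup>2) + (x * y' + y * x') * s"
      by (simp add: p q algebra_simps power2_eq_square)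
    then have "\<psi> (p * q) = \<phi> (x * x' + y * y' * s\<^sup>2) + \<phi> (x * y' + y * x') * s'"
      using psi[of "x * x' + y * y' * s\<^sup>2" "x * y' + y * x'"] xy sq by (simp add: subfield_closed)
    also have "\<dots> = (\<phi> x * \<phi> x' + \<phi> y * \<phi> y' * s'\<^sup>2) + (\<phi> x * \<phi> y' + \<phi> y * \<phi> x') * s'"
      using xy sq by (simp add: hs subfield_closed s')
    also have "\<dots> = \<psi> p * \<psi> q"
      using psi[of x y] psi[of x' y'] xy by (simp add: p q algebra_simps power2_eq_square)
    finally show "\<psi> (p * q) = \<psi> p * \<psi> q" .
  qed
  ultimately show thesis using that agree by blast
qed

text \<open>By independence every \<open>w i\<close> is new when it is adjoined, so each image can
  be prescribed separately as any square root of the image of its radicand.\<close>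

lemma hom_on_extend_independent:
  fixes w :: "'i \<Rightarrow> 'a::field_char_0"
  assumes "finite I" "hom_on (gen_field A) \<phi>"
    and "\<And>i. i \<in> I \<Longrightarrow> (w i)\<^sup>2 \<in> gen_field A"
    and "\<And>i. i \<in> I \<Longrightarrow> w i \<notin> gen_field (A \<union> w ` (I - {i}))"
    and "\<And>i. i \<in> I \<Longrightarrow> (g i)\<^sup>2 = \<phi> ((w i)\<^sup>2)"
  shows "\<exists>\<psi>. hom_on (gen_field (A \<union> w ` I)) \<psi> \<and> (\<forall>x\<in>gen_field A. \<psi> x = \<phi> x) \<and> (\<forall>i\<in>I. \<psi> (w i) = g i)"
  using assms
proof (induction I rule: finite_induct)
  case empty
  then show ?case by auto
next
  case (insert i I)
  have "w j \<notin> gen_field (A \<union> w ` (I - {j}))" if "j \<in> I" for j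
    using insert.prems(3)[of j] that gen_field_mono[of "A \<union> w ` (I - {j})" "A \<union> w ` (insert i I - {j})"]
    by blast
  then obtain \<psi> where \<psi>: "hom_on (gen_field (A \<union> w ` I)) \<psi>" "\<forall>x\<in>gen_field A. \<psi> x = \<phi> x"
    "\<forall>i\<in>I. \<psi> (w i) = g i"
    using insert.IH insert.prems by auto
  have AE: "gen_field A \<subseteq> gen_field (A \<union> w ` I)" by (intro gen_field_mono) auto
  have "w i \<notin> gen_field (A \<union> w ` I)"
    using insert.prems(3)[of i] insert.hyps by simp
  moreover have "(g i)\<^sup>2 = \<psi> ((w i)\<^sup>2)" using \<psi>(2) insert.prems by auto
  ultimately obtain \<psi>' where \<psi>': "hom_on (gen_field (insert (w i) (A \<union> w ` I))) \<psi>'"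
    "\<And>x. x \<in> gen_field (A \<union> w ` I) \<Longrightarrow> \<psi>' x = \<psi> x" "\<psi>' (w i) = g i"
    using hom_on_extend_quadratic[OF \<psi>(1), of "w i" "g i"] AE insert.prems by blast
  have "w j \<in> gen_field (A \<union> w ` I)" if "j \<in> I" for j
    using that by (auto intro: gen_field_inc)
  then show ?case using \<psi> \<psi>' AE by (intro exI[of _ \<psi>']) auto
qed

text \<open>Without independence the images cannot be prescribed, but an extension still exists: an
  element already present changes nothing, and for a new one the complex numbers contain a square
  root of the image of its radicand.\<close>

lemma hom_on_extend_quadratics:
  fixes U :: "complex set"
  assumes "finite U" "hom_on (gen_field A) \<phi>" "\<And>u. u \<in> U \<Longrightarrow> u\<^sup>2 \<in> gen_field A"
  shows "\<exists>\<psi>. hom_on (gen_field (A \<union> U)) \<psi> \<and> (\<forall>x\<in>gen_field A. \<psi> x = \<phi> x)"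
  using assms
proof (induction U rule: finite_induct)
  case empty
  then show ?case by auto
next
  case (insert u U)
  then obtain \<psi> where \<psi>: "hom_on (gen_field (A \<union> U)) \<psi>" "\<forall>x\<in>gen_field A. \<psi> x = \<phi> x"
    by auto
  have AE: "gen_field A \<subseteq> gen_field (A \<union> U)" by (intro gen_field_mono) auto
  show ?case
  proof (cases "u \<in> gen_field (A \<union> U)")
    case True
    then show ?thesis using \<psi> gen_field_insert_absorb[OF True] by auto
  next
    case False
    have "u\<^sup>2 \<in> gen_field (A \<union> U)" using AE insert.prems by blast
    then obtain \<psi>' where "hom_on (gen_field (insert u (A \<union> U))) \<psi>'"
      "\<And>x. x \<in> gen_field (A \<union> U) \<Longrightarrow> \<psi>' x = \<psi> x"
      by (rule hom_on_extend_quadratic[OF \<psi>(1) _ False, of "csqrt (\<psi> (u\<^sup>2))"]) auto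
    then show ?thesis using \<psi> AE by (intro exI[of _ \<psi>']) auto
  qed
qed

section \<open>Homomorphisms that move a given element\<close>

text \<open>A substitute for the Galois correspondence. At the step where \<open>x\<close> first
  enters the field, it has the form \<open>a + b * u\<close> with \<open>b * u\<close> nonzero, so
  negating \<open>u\<close> moves it; the later square roots only require an extension.\<close>

lemma hom_on_moving:
  fixes U :: "complex set"
  assumes "finite U" "\<And>u. u \<in> U \<Longrightarrow> u\<^sup>2 \<in> gen_field A"
    and "x \<in> gen_field (A \<union> U)" "x \<notin> gen_field A"
  shows "\<exists>\<psi>. hom_on (gen_field (A \<union> U)) \<psi> \<and> (\<forall>y\<in>gen_field A. \<psi> y = y) \<and> \<psi> x \<noteq> x"
  using assms
proof (induction U rule: finite_induct)
  case empty
  then show ?case by auto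
next
  case (insert u U)
  let ?E = "gen_field (A \<union> U)"
  have AE: "gen_field A \<subseteq> ?E" by (intro gen_field_mono) auto
  have uE: "u\<^sup>2 \<in> ?E" using insert.prems AE by auto
  show ?case
  proof (cases "x \<in> ?E")
    case True
    then obtain \<psi> where \<psi>: "hom_on ?E \<psi>" "\<forall>y\<in>gen_field A. \<psi> y = y" "\<psi> x \<noteq> x"
      using insert by auto
    obtain \<psi>' where "hom_on (gen_field (A \<union> U \<union> {u})) \<psi>'" "\<forall>x\<in>?E. \<psi>' x = \<psi> x"
      using hom_on_extend_quadratics[OF _ \<psi>(1), of "{u}"] uE by auto
    then show ?thesis using \<psi> AE True by (intro exI[of _ \<psi>']) auto
  next
    case False
    obtain a b where ab: "a \<in> ?E" "b \<in> ?E" "x = a + b * u"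
      using insert.prems(2) gen_field_insert_quadratic[OF uE] by auto
    have u: "u \<notin> ?E" using ab False by (auto intro: subfield_closed)
    obtain \<psi> where \<psi>: "hom_on (gen_field (insert u (A \<union> U))) \<psi>"
      "\<And>y. y \<in> ?E \<Longrightarrow> \<psi> y = y" "\<psi> u = - u"
      using hom_on_extend_quadratic[OF hom_on_id uE u, of "- u"] by auto
    have E': "?E \<subseteq> gen_field (insert u (A \<union> U))" by (intro gen_field_mono) auto
    have "u \<in> gen_field (insert u (A \<union> U))" by (simp add: gen_field_inc)
    moreover have "a \<in> gen_field (insert u (A \<union> U))" "b \<in> gen_field (insert u (A \<union> U))"
      using ab E' by blast+
    ultimately have "\<psi> x = a - b * u"
      using ab(1,2) \<psi>(2,3)
      by (simp add: ab(3) hom_on_add[OF \<psi>(1)] hom_on_mult[OF \<psi>(1)] subfield_mult)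
    moreover have "b * u \<noteq> 0" using False ab by auto
    ultimately have "\<psi> x \<noteq> x" using ab by simp
    then show ?thesis using \<psi> AE by (intro exI[of _ \<psi>]) auto
  qed
qed

text \<open>The version for nested square roots: either \<open>x\<close> is moved in the lower layer
  and the homomorphism extends to the upper one, or it is moved in the upper layer with the lower
  one fixed.\<close>

lemma hom_on_moving_two_steps:
  fixes U V :: "complex set"
  assumes "finite U" "finite V" "\<And>u. u \<in> U \<Longrightarrow> u\<^sup>2 \<in> gen_field A"
    and V: "\<And>v. v \<in> V \<Longrightarrow> v\<^sup>2 \<in> gen_field (A \<union> U)"
    and "x \<in> gen_field (A \<union> U \<union> V)" "x \<notin> gen_field A"
  obtains \<psi> where "hom_on (gen_field (A \<union> U \<union> V)) \<psi>" "\<forall>y\<in>gen_field A. \<psi> y = y" "\<psi> x \<noteq> x"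
proof -
  have AE: "gen_field A \<subseteq> gen_field (A \<union> U)" by (intro gen_field_mono) auto
  show thesis
  proof (cases "x \<in> gen_field (A \<union> U)")
    case True
    then obtain \<psi> where \<psi>: "hom_on (gen_field (A \<union> U)) \<psi>" "\<forall>y\<in>gen_field A. \<psi> y = y" "\<psi> x \<noteq> x"
      using hom_on_moving[of U A x] assms by blast
    obtain \<psi>' where "hom_on (gen_field (A \<union> U \<union> V)) \<psi>'" "\<forall>x\<in>gen_field (A \<union> U). \<psi>' x = \<psi> x"
      using hom_on_extend_quadratics[OF _ \<psi>(1), of V] V assms by blast
    then show ?thesis using that[of \<psi>'] \<psi> AE True by (simp add: subset_iff)
  next
    case False
    then obtain \<psi> where "hom_on (gen_field (A \<union> U \<union> V)) \<psi>" "\<forall>y\<in>gen_field (A \<union> U). \<psi> y = y" "\<psi> x \<noteq> x"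
      using hom_on_moving[of V "A \<union> U" x] assms by blast
    then show ?thesis using that[of \<psi>] AE by auto
  qed
qed

section \<open>Rational polynomials with prescribed roots\<close>

lemma map_poly_of_rat_add:
  "map_poly of_rat (p + q) = (map_poly of_rat p + map_poly of_rat q :: 'a::field_char_0 poly)"
  by (intro poly_eqI) (simp add: coeff_map_poly of_rat_add)

lemma map_poly_of_rat_mult:
  "map_poly of_rat (p * q) = (map_poly of_rat p * map_poly of_rat q :: 'a::field_char_0 poly)"
  by (intro poly_eqI) (simp add: coeff_map_poly coeff_mult of_rat_sum of_rat_mult)

lemma degree_map_poly_of_rat: "degree (map_poly of_rat p :: 'a::field_char_0 poly) = degree p"
  by (simp add: degree_map_poly)

lemma map_poly_of_rat_eq_0_iff: "(map_poly of_rat p :: 'a::field_char_0 poly) = 0 \<longleftrightarrow> p = 0"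
  by (simp add: map_poly_eq_0_iff)

lemma map_poly_of_rat_pcompose:
  "map_poly of_rat (pcompose p q) = (pcompose (map_poly of_rat p) (map_poly of_rat q) :: 'a::field_char_0 poly)"
  by (induction p)
     (simp_all add: pcompose_pCons map_poly_pCons map_poly_of_rat_add map_poly_of_rat_mult)

lemma finite_roots_of: "f \<noteq> 0 \<Longrightarrow> finite (roots_of f)"
  by (simp add: roots_of_def poly_roots_finite map_poly_of_rat_eq_0_iff)

lemma card_roots_of_le: "f \<noteq> 0 \<Longrightarrow> card (roots_of f) \<le> degree f"
  using card_poly_roots_bound[of "map_poly of_rat f :: complex poly"]
  by (simp add: roots_of_def map_poly_of_rat_eq_0_iff degree_map_poly_of_rat)

text \<open>The homomorphisms permute \<open>R\<close>, so the coefficients of the product of the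
  linear factors are fixed and hence rational. A rational factor vanishing at
  \<open>\<theta>\<close> vanishes on all of \<open>R\<close> by transitivity, which leaves degree 0
  for the cofactor.\<close>

lemma irreducible_poly_of_orbit:
  fixes R :: "complex set"
  assumes L: "is_subfield L" and fin: "finite R" and RL: "R \<subseteq> L" and \<theta>: "\<theta> \<in> R"
    and fixed: "\<And>x. x \<in> L \<Longrightarrow> (\<And>\<psi>. hom_on L \<psi> \<Longrightarrow> \<psi> x = x) \<Longrightarrow> x \<in> \<rat>"
    and stable: "\<And>\<psi> r. hom_on L \<psi> \<Longrightarrow> r \<in> R \<Longrightarrow> \<psi> r \<in> R"
    and trans: "\<And>r. r \<in> R \<Longrightarrow> \<exists>\<psi>. hom_on L \<psi> \<and> \<psi> \<theta> = r"
  obtains f where "irreducible f" "lead_coeff f = 1" "roots_of f = R"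
proof -
  define P where "P = (\<Prod>r\<in>R. [:- r, 1:])"
  have "coeff P n \<in> \<rat>" for n
  proof (rule fixed)
    show "coeff P n \<in> L" unfolding P_def
      using hom_on_coeff_prod[OF L hom_on_id fin RL] by blast
    fix \<psi> assume \<psi>: "hom_on L \<psi>"
    have "inj_on \<psi> R"
    proof (rule inj_onI)
      fix a b assume ab: "a \<in> R" "b \<in> R" "\<psi> a = \<psi> b"
      then have "\<psi> (a - b) = 0" using hom_on_diff[OF L \<psi>, of a b] RL by auto
      then show "a = b" using hom_on_eq_0_iff[OF L \<psi>, of "a - b"] ab RL L by (auto intro: subfield_diff)
    qed
    moreover have "\<psi> ` R \<subseteq> R" using stable[OF \<psi>] by blast
    ultimately have bij: "bij_betw \<psi> R R" using endo_inj_surj[OF fin] by (simp add: bij_betw_def)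
    have "\<psi> (coeff P n) = coeff (\<Prod>r\<in>R. [:- \<psi> r, 1:]) n"
      unfolding P_def using hom_on_coeff_prod[OF L \<psi> fin RL] by blast
    also have "(\<Prod>r\<in>R. [:- \<psi> r, 1:]) = P"
      unfolding P_def by (rule prod.reindex_bij_betw[OF bij])
    finally show "\<psi> (coeff P n) = coeff P n" .
  qed
  then obtain f where f: "P = map_poly of_rat f" using ratpolyE by blast
  have roots: "roots_of f = R"
    unfolding roots_of_def f[symmetric] P_def by (auto simp: poly_prod fin)
  have deg: "degree f = card R"
    using degree_map_poly_of_rat[of f, where 'a = complex] unfolding f[symmetric] P_def
    by (simp add: degree_prod_sum_eq)
  have "lead_coeff P = 1" unfolding P_def by (simp add: lead_coeff_prod)
  then have monic: "lead_coeff f = 1"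
    unfolding f degree_map_poly_of_rat by (simp add: coeff_map_poly)
  have cR: "card R > 0" using fin \<theta> card_gt_0_iff by blast
  have "f \<noteq> 0" using monic by auto
  moreover have "is_unit a \<or> is_unit b" if ab: "f = a * b" for a b
  proof -
    have nz: "a \<noteq> 0" "b \<noteq> 0" using \<open>f \<noteq> 0\<close> ab by auto
    \<comment> \<open>A nonzero rational polynomial with root \<open>\<theta>\<close> also has all
      its images as roots.\<close>
    have full: "degree p \<ge> card R" if "p \<noteq> 0" "poly (map_poly of_rat p) \<theta> = 0" for p
    proof -
      have "R \<subseteq> roots_of p"
      proof
        fix r assume "r \<in> R"
        then obtain \<psi> where \<psi>: "hom_on L \<psi>" "\<psi> \<theta> = r" using trans by blast
        have "\<psi> (poly (map_poly of_rat p) \<theta>) = poly (map_poly of_rat p) r"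
          using hom_on_poly[OF L \<psi>(1), of \<theta> p] \<theta> RL \<psi>(2) by auto
        then show "r \<in> roots_of p" using that hom_on_0[OF L \<psi>(1)] by (simp add: roots_of_def)
      qed
      then have "card R \<le> card (roots_of p)" using finite_roots_of[OF that(1)] card_mono by blast
      then show ?thesis using card_roots_of_le[OF that(1)] by simp
    qed
    have "poly (map_poly of_rat (a * b)) \<theta> = 0"
      using \<theta> roots unfolding roots_of_def ab by blast
    then have "poly (map_poly of_rat a) \<theta> = 0 \<or> poly (map_poly of_rat b) \<theta> = 0"
      by (simp add: map_poly_of_rat_mult)
    then have "degree a \<ge> card R \<or> degree b \<ge> card R" using full nz by blast
    moreover have "degree a + degree b = card R" using deg ab nz by (simp add: degree_mult_eq)
    ultimately have "degree a = 0 \<or> degree b = 0" by linarith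
    then show ?thesis using nz by (simp add: is_unit_iff_degree)
  qed
  moreover have "\<not> is_unit f" using deg cR \<open>f \<noteq> 0\<close> by (simp add: is_unit_iff_degree)
  ultimately have "irreducible f" by (intro irreducibleI)
  then show thesis using that monic roots by blast
qed

section \<open>Translation by rational numbers\<close>

lemma roots_of_shift:
  "roots_of (pcompose f [:- c, 1:]) = (+) (of_rat c) ` roots_of f"
proof -
  have "z \<in> roots_of (pcompose f [:- c, 1:]) \<longleftrightarrow> z - of_rat c \<in> roots_of f" for z
    by (simp add: roots_of_def map_poly_of_rat_pcompose map_poly_pCons poly_pcompose of_rat_minus)
  moreover have "z \<in> (+) d ` S \<longleftrightarrow> z - d \<in> S" for z d :: complex and S
    by (metis add_diff_cancel_left' diff_add_cancel add.commute image_iff)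
  ultimately show ?thesis by blast
qed

text \<open>Translating back turns a factorisation of the translate into one of \<open>f\<close>,
  and degrees are preserved both ways.\<close>

lemma irreducible_shift:
  fixes f :: "'a::field poly"
  assumes "irreducible f"
  shows "irreducible (pcompose f [:- c, 1:])"
proof (rule irreducibleI)
  have "f \<noteq> 0" "degree f \<noteq> 0"
    using assms by (auto simp: irreducible_def is_unit_iff_degree)
  then have "degree (pcompose f [:- c, 1:]) \<noteq> 0" by (simp add: degree_pcompose)
  then show "pcompose f [:- c, 1:] \<noteq> 0" "\<not> is_unit (pcompose f [:- c, 1:])"
    by (metis degree_0, metis degree_0 is_unit_iff_degree)
  fix a b assume ab: "pcompose f [:- c, 1:] = a * b"
  have "f = pcompose (pcompose f [:- c, 1:]) [:c, 1:]"
    by (simp add: pcompose_pCons flip: pcompose_assoc)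
  then have "f = pcompose a [:c, 1:] * pcompose b [:c, 1:]" by (simp add: ab pcompose_mult)
  then have "is_unit (pcompose a [:c, 1:]) \<or> is_unit (pcompose b [:c, 1:])"
    using assms unfolding irreducible_def by blast
  moreover have "a \<noteq> 0" "b \<noteq> 0" using ab \<open>pcompose f [:- c, 1:] \<noteq> 0\<close> by auto
  moreover have "degree (pcompose p [:c, 1:]) = degree p" for p by (simp add: degree_pcompose)
  moreover have "pcompose p [:c, 1:] \<noteq> 0" if "p \<noteq> 0" for p
    using that pcompose_eq_0[of p "[:c, 1:]"] by auto
  ultimately show "is_unit a \<or> is_unit b" by (auto simp: is_unit_iff_degree)
qed

lemma gen_field_shift:
  assumes "c \<in> \<rat>"
  shows "gen_field ((+) c ` B) = gen_field (B :: complex set)"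
proof -
  have sub: "gen_field ((+) c ` B) \<subseteq> gen_field B" if "c \<in> \<rat>" for c and B :: "complex set"
  proof (rule gen_field_minimal)
    have "c \<in> gen_field B" using that subfield_Rats[of "gen_field B"] by blast
    then show "(+) c ` B \<subseteq> gen_field B" using gen_field_superset[of B] by (auto intro!: subfield_add)
  qed simp
  have "B = (+) (- c) ` (+) c ` B" by (simp add: image_image)
  then have "gen_field B \<subseteq> gen_field ((+) c ` B)" using sub[of "- c" "(+) c ` B"] assms by simp
  then show ?thesis using sub[OF assms] by blast
qed

lemma minimal_generating_set_shift:
  assumes "minimal_generating_set f B"
  shows "minimal_generating_set (pcompose f [:- c, 1:]) ((+) (of_rat c) ` B)"
proof -
  note eqs = rat_adjoin_eq_gen_field splitting_field_def roots_of_shift gen_field_shift[OF Rats_of_rat]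
  have "gen_field A \<noteq> gen_field (roots_of f)" if A: "A \<subset> (+) (of_rat c) ` B" for A
  proof -
    \<comment> \<open>Translating \<open>A\<close> back gives a proper subset of \<open>B\<close>
      that generates the same field as \<open>A\<close>.\<close>
    have "(+) (- of_rat c) ` A \<subset> (+) (- of_rat c) ` (+) (of_rat c) ` B"
      using A by (subst image_strict_mono) auto
    then have "(+) (- of_rat c) ` A \<subset> B" by (simp add: image_image)
    then have "gen_field ((+) (of_rat (- c)) ` A) \<noteq> gen_field (roots_of f)"
      using assms by (auto simp: minimal_generating_set_def eqs of_rat_minus)
    then show ?thesis unfolding gen_field_shift[OF Rats_of_rat] .
  qed
  then show ?thesis using assms by (auto simp: minimal_generating_set_def eqs)
qed

text \<open>All rational translates of \<open>f\<close> belong to the set. Finitely many polynomials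
  would have finitely many roots in total, but a root \<open>r\<close> of \<open>f\<close> yields
  the roots \<open>n + r\<close> for every natural \<open>n\<close>.\<close>

lemma infinite_mingen_polys_same_degree:
  assumes "f \<in> mingen_polys k"
  shows "infinite {g \<in> mingen_polys k. degree g = degree f}"
proof
  let ?M = "{g \<in> mingen_polys k. degree g = degree f}"
  assume fin: "finite ?M"
  have f: "irreducible f" "lead_coeff f = 1" using assms by (auto simp: mingen_polys_def)
  have shift: "pcompose f [:- c, 1:] \<in> ?M" for c
  proof -
    obtain B C where BC: "minimal_generating_set f B" "card B = 2"
      "minimal_generating_set f C" "card C = k"
      using assms by (auto simp: mingen_polys_def)
    have "minimal_generating_set (pcompose f [:- c, 1:]) ((+) (of_rat c) ` B)"
      "minimal_generating_set (pcompose f [:- c, 1:]) ((+) (of_rat c) ` C)"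
      using BC minimal_generating_set_shift by blast+
    moreover have "card ((+) (of_rat c :: complex) ` B) = 2" "card ((+) (of_rat c :: complex) ` C) = k"
      using BC by (simp_all add: card_image)
    ultimately show ?thesis
      using f irreducible_shift[of f c] lead_coeff_comp[of "[:- c, 1:]" f]
      unfolding mingen_polys_def by (auto simp: degree_pcompose)
  qed
  have "degree f \<noteq> 0" using f by (auto simp: irreducible_def is_unit_iff_degree)
  then have "degree (map_poly of_rat f :: complex poly) \<noteq> 0" by (simp add: degree_map_poly_of_rat)
  then obtain r where r: "r \<in> roots_of f"
    using fundamental_theorem_of_algebra_alt constant_degree unfolding roots_of_def
    by (metis (mono_tags, lifting) mem_Collect_eq fundamental_theorem_of_algebra)
  have "finite (\<Union>g\<in>?M. roots_of g)"
    using fin by (intro finite_UN_I finite_roots_of) (auto simp: mingen_polys_def)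
  moreover have "range (\<lambda>n. of_nat n + r) \<subseteq> (\<Union>g\<in>?M. roots_of g)"
  proof (rule image_subsetI)
    fix n
    have "of_rat (of_nat n) + r \<in> roots_of (pcompose f [:- of_nat n, 1:])"
      unfolding roots_of_shift using r by (rule imageI)
    then show "of_nat n + r \<in> (\<Union>g\<in>?M. roots_of g)" using shift[of "of_nat n"] by auto
  qed
  ultimately have "finite (range (\<lambda>n. of_nat n + r))" using finite_subset by blast
  moreover have "inj (\<lambda>n. of_nat n + r)" by (auto simp: inj_def)
  ultimately show False using finite_imageD infinite_UNIV_nat by blast
qed

section \<open>Sums of roots of independent quartics\<close>

lemma hom_on_gen_field_image:
  fixes \<phi> :: "'a::field_char_0 \<Rightarrow> 'a"
  assumes \<phi>: "hom_on (gen_field A) \<phi>" and AB: "\<And>a. a \<in> A \<Longrightarrow> \<phi> a \<in> gen_field B"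
    and x: "x \<in> gen_field A"
  shows "\<phi> x \<in> gen_field B"
proof -
  have K: "is_subfield (gen_field A)" by simp
  have "is_subfield {x \<in> gen_field A. \<phi> x \<in> gen_field B}"
    unfolding is_subfield_def
    by (auto simp: hom_on_0[OF K \<phi>] hom_on_1[OF \<phi>] hom_on_add[OF \<phi>] hom_on_mult[OF \<phi>]
        hom_on_uminus[OF K \<phi>] hom_on_inverse[OF K \<phi>] subfield_closed)
  then have "gen_field A \<subseteq> {x \<in> gen_field A. \<phi> x \<in> gen_field B}"
    using AB by (intro gen_field_minimal) (auto intro: gen_field_inc)
  then show ?thesis using x by blast
qed

lemma hom_on_gen_field_id:
  fixes \<phi> :: "'a::field_char_0 \<Rightarrow> 'a"
  assumes \<phi>: "hom_on (gen_field A) \<phi>" and A: "\<And>a. a \<in> A \<Longrightarrow> \<phi> a = a" and x: "x \<in> gen_field A"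
  shows "\<phi> x = x"
proof -
  have "gen_field A \<subseteq> {x \<in> gen_field A. \<phi> x = x}"
    using A by (intro gen_field_minimal subfield_hom_fixed \<phi>) (auto intro: gen_field_inc)
  then show ?thesis using x by blast
qed

section \<open>The quartics and their fields\<close>

text \<open>\<open>w (i, True)\<close> and \<open>w (i, False)\<close> are the roots $a_i$ and
  $b_i$, and \<open>u i\<close> is the inner square root. Independence modulo squares is expressed
  through \<open>t i * (t i - 1)\<close>, the product of the two conjugate radicands, and
  \<open>t j\<close>.\<close>

locale independent_quartics =
  fixes k :: nat and t :: "nat \<Rightarrow> nat" and u :: "nat \<Rightarrow> complex" and w :: "nat \<times> bool \<Rightarrow> complex"
  assumes t: "i < k \<Longrightarrow> t i \<ge> 2"
    and u: "i < k \<Longrightarrow> (u i)\<^sup>2 = of_nat (t i)"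
    and w: "i < k \<Longrightarrow> (w (i, b))\<^sup>2 = of_nat (t i) + (if b then u i else - u i)"
    and indep: "\<lbrakk>I \<subseteq> {..<k}; J \<subseteq> {..<k}; q \<in> \<rat>;
      (q :: complex)\<^sup>2 = of_nat ((\<Prod>i\<in>I. t i * (t i - 1)) * (\<Prod>j\<in>J. t j))\<rbrakk> \<Longrightarrow> I = {} \<and> J = {}"
begin

definition X :: "(nat \<times> bool) set" where "X = {..<k} \<times> UNIV"
definition F :: "complex set" where "F = gen_field (u ` {..<k})"
definition L :: "complex set" where "L = gen_field (w ` X)"
definition \<beta> :: "nat \<times> bool \<Rightarrow> complex" where
  "\<beta> p = of_nat (t (fst p)) + (if snd p then u (fst p) else - u (fst p))"
text \<open>The root set of the quartic, given by its equation with integer coefficients, so that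
  homomorphisms visibly preserve it; \<open>Q_iff\<close> lists the roots.\<close>

definition Q :: "nat \<Rightarrow> complex set" where "Q i = {y. (y\<^sup>2 - of_nat (t i))\<^sup>2 = of_nat (t i)}"
definition R :: "complex set" where "R = {\<Sum>i<k. g i |g. \<forall>i<k. g i \<in> Q i}"

lemma subfield_F: "is_subfield F" and subfield_L: "is_subfield L"
  by (simp_all add: F_def L_def)

lemma finite_X: "finite X" by (simp add: X_def)

lemma X_iff: "(i, b) \<in> X \<longleftrightarrow> i < k" by (simp add: X_def)

lemma w_sq: "p \<in> X \<Longrightarrow> (w p)\<^sup>2 = \<beta> p"
  by (cases p) (simp add: \<beta>_def X_iff w)

lemma u_in_F: "i < k \<Longrightarrow> u i \<in> F"
  by (auto simp: F_def intro: gen_field_inc)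

lemma \<beta>_in_F: "p \<in> X \<Longrightarrow> \<beta> p \<in> F"
  by (cases p) (auto simp: \<beta>_def X_iff intro!: subfield_add subfield_diff subfield_of_nat subfield_F u_in_F)

text \<open>The difference of squares $(t + u)(t - u) = t^2 - t$, which is the source of the numbers
  \<open>t i * (t i - 1)\<close> in \<open>indep\<close>.\<close>

lemma \<beta>_mult: "i < k \<Longrightarrow> \<beta> (i, b) * \<beta> (i, \<not> b) = of_nat (t i * (t i - 1))"
  using t[of i] u[of i] by (cases b) (auto simp: \<beta>_def algebra_simps power2_eq_square of_nat_diff)

lemma \<beta>_nonzero: "p \<in> X \<Longrightarrow> \<beta> p \<noteq> 0"
proof
  assume p: "p \<in> X" and "\<beta> p = 0"
  then have "(of_nat (t (fst p) * (t (fst p) - 1)) :: complex) = 0"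
    using \<beta>_mult[of "fst p" "snd p"] by (cases p) (simp add: X_iff)
  then show False using p t[of "fst p"] by (cases p) (simp add: X_iff)
qed

lemma w_in_L: "p \<in> X \<Longrightarrow> w p \<in> L"
  by (auto simp: L_def intro: gen_field_inc)

lemma u_in_L: "i < k \<Longrightarrow> u i \<in> L"
proof -
  assume i: "i < k"
  then have "u i = (w (i, True))\<^sup>2 - of_nat (t i)" by (simp add: w)
  then show ?thesis
    using w_in_L[of "(i, True)"] i by (simp add: X_iff subfield_closed subfield_L)
qed

text \<open>Presents \<open>L\<close> as a tower of two layers of square roots over
  \<open>gen_field S\<close>, the form required by \<open>hom_on_moving_two_steps\<close>.\<close>

lemma gen_field_eq_L: "S \<subseteq> L \<Longrightarrow> gen_field (S \<union> u ` {..<k} \<union> w ` X) = L"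
proof
  assume "S \<subseteq> L"
  then show "gen_field (S \<union> u ` {..<k} \<union> w ` X) \<subseteq> L"
    by (intro gen_field_minimal subfield_L) (auto intro: u_in_L w_in_L)
  show "L \<subseteq> gen_field (S \<union> u ` {..<k} \<union> w ` X)"
    unfolding L_def by (rule gen_field_mono) auto
qed

section \<open>Independence of the square roots\<close>

text \<open>By Kummer theory over the rationals a dependence would make a nonempty product of
  distinct \<open>u j\<close> rational, against \<open>indep\<close>. The union with
  \<open>{}\<close> matches the form of \<open>hom_on_extend_independent\<close> over the
  rationals.\<close>

lemma u_independent: "i < k \<Longrightarrow> u i \<notin> gen_field ({} \<union> u ` ({..<k} - {i}))"
proof
  assume i: "i < k" and mem: "u i \<in> gen_field ({} \<union> u ` ({..<k} - {i}))"
  have "\<exists>J\<subseteq>{..<k} - {i}. u i * prod u J \<in> gen_field {}"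
    using i mem by (intro quadratic_kummer) (auto simp: u subfield_of_nat)
  then obtain J where J: "J \<subseteq> {..<k} - {i}" "u i * prod u J \<in> \<rat>"
    by (auto simp: gen_field_empty)
  then have "finite J" "i \<notin> J" using finite_subset by blast+
  then have "u i * prod u J = prod u (insert i J)" by simp
  moreover have "(prod u (insert i J))\<^sup>2 = of_nat (\<Prod>j\<in>insert i J. t j)"
    using J(1) i unfolding prod_power_distrib of_nat_prod
    by (intro prod.cong) (auto simp: u)
  ultimately show False
    using indep[of "{}" "insert i J" "prod u (insert i J)"] J i by auto
qed

text \<open>Kummer theory carries the question from \<open>F\<close> down to the rationals: a square
  root \<open>z\<close> in \<open>F\<close> becomes rational after multiplication by some
  \<open>u j\<close>, and the square of the result is excluded by \<open>indep\<close>.\<close>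

lemma prod_mult_pred_not_square:
  assumes "I \<subseteq> {..<k}" "I \<noteq> {}" "z \<in> F"
  shows "z\<^sup>2 \<noteq> of_nat (\<Prod>i\<in>I. t i * (t i - 1))"
proof
  assume z: "z\<^sup>2 = of_nat (\<Prod>i\<in>I. t i * (t i - 1))"
  have "\<exists>J\<subseteq>{..<k}. z * prod u J \<in> gen_field {}"
  proof (rule quadratic_kummer)
    show "z \<in> gen_field ({} \<union> u ` {..<k})" using assms(3) by (simp add: F_def)
    show "z\<^sup>2 \<in> gen_field {}" unfolding z by (rule subfield_of_nat) simp
    show "(u i)\<^sup>2 \<in> gen_field {}" if "i \<in> {..<k}" for i
      using that by (simp add: u subfield_of_nat)
  qed simp
  then obtain J where J: "J \<subseteq> {..<k}" "z * prod u J \<in> \<rat>"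
    by (auto simp: gen_field_empty)
  have "(prod u J)\<^sup>2 = of_nat (\<Prod>j\<in>J. t j)"
    using J(1) unfolding prod_power_distrib of_nat_prod
    by (intro prod.cong) (auto simp: u)
  then have "(z * prod u J)\<^sup>2 = of_nat ((\<Prod>i\<in>I. t i * (t i - 1)) * (\<Prod>j\<in>J. t j))"
    by (simp only: power_mult_distrib z of_nat_mult)
  then show False using indep[OF assms(1) J(1) J(2)] assms(2) by blast
qed

text \<open>If a product of the \<open>w p\<close> lies in \<open>F\<close> and separates the two square roots over some \<open>i\<close>,
  multiply it with its image under the automorphism negating \<open>u i\<close>; otherwise square it. In both
  cases a product of numbers \<open>t i * (t i - 1)\<close> becomes a square in \<open>F\<close>.\<close>

lemma prod_w_notin_F:
  assumes T: "T \<subseteq> X" "T \<noteq> {}"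
  shows "prod w T \<notin> F"
proof
  assume P: "prod w T \<in> F"
  have finT: "finite T" using T finite_X finite_subset by blast
  have P2: "(prod w T)\<^sup>2 = prod \<beta> T"
    using T(1) unfolding prod_power_distrib by (intro prod.cong) (auto simp: w_sq)
  show False
  proof (cases "\<exists>i b. (i, b) \<in> T \<and> (i, \<not> b) \<notin> T")
    case True
    then obtain i b where ib: "(i, b) \<in> T" "(i, \<not> b) \<notin> T" by blast
    then have i: "i < k" using T X_iff by blast
    have "\<exists>\<sigma>. hom_on (gen_field ({} \<union> u ` {..<k})) \<sigma> \<and> (\<forall>x\<in>gen_field {}. \<sigma> x = x) \<and>
        (\<forall>j\<in>{..<k}. \<sigma> (u j) = (if j = i then - u j else u j))"
      using u_independent
      by (intro hom_on_extend_independent hom_on_id) (auto simp: u subfield_of_nat)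
    then obtain \<sigma> where \<sigma>: "hom_on F \<sigma>" and \<sigma>u: "\<And>j. j < k \<Longrightarrow> \<sigma> (u j) = (if j = i then - u j else u j)"
      by (auto simp: F_def)
    note \<sigma>_simps = hom_on_add[OF \<sigma>] hom_on_mult[OF \<sigma>] hom_on_uminus[OF subfield_F \<sigma>]
      hom_on_of_nat[OF subfield_F \<sigma>]
    have \<sigma>\<beta>: "\<sigma> (\<beta> (j, c)) = (if j = i then \<beta> (j, \<not> c) else \<beta> (j, c))" if "j < k" for j c
      using that by (simp add: \<beta>_def \<sigma>_simps \<sigma>u subfield_of_nat[OF subfield_F] u_in_F subfield_uminus[OF subfield_F])
    \<comment> \<open>The remaining radicands. None of them belongs to the index \<open>i\<close>,
      so \<open>\<sigma>\<close> fixes \<open>m\<close>, while it exchanges the two radicands over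
      \<open>i\<close>.\<close>
    define m where "m = prod \<beta> (T - {(i, b)})"
    have P2m: "(prod w T)\<^sup>2 = \<beta> (i, b) * m"
      unfolding P2 m_def using finT ib by (simp add: prod.remove)
    have m: "m \<in> F" unfolding m_def using T by (intro subfield_prod subfield_F \<beta>_in_F) auto
    have m0: "m \<noteq> 0" unfolding m_def using finT T \<beta>_nonzero by (auto simp: prod_zero_iff)
    have "\<sigma> m = (\<Prod>p\<in>T - {(i, b)}. \<sigma> (\<beta> p))"
      unfolding m_def using T \<beta>_in_F by (intro hom_on_prod[OF subfield_F \<sigma>]) auto
    also have "\<dots> = m" unfolding m_def
    proof (intro prod.cong refl)
      fix p assume p: "p \<in> T - {(i, b)}"
      obtain j c where jc: "p = (j, c)" by (cases p)
      have "j \<noteq> i" using p ib jc by (cases "c = b") auto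
      moreover have "j < k" using p T jc X_iff by blast
      ultimately show "\<sigma> (\<beta> p) = \<beta> p" using \<sigma>\<beta>[of j c] jc by simp
    qed
    finally have \<sigma>m: "\<sigma> m = m" .
    have "(\<sigma> (prod w T))\<^sup>2 = \<sigma> (\<beta> (i, b) * m)"
      using hom_on_power[OF subfield_F \<sigma> P, of 2] P2m by simp
    also have "\<dots> = \<beta> (i, \<not> b) * m"
      using \<sigma>\<beta>[OF i, of b] m \<beta>_in_F[of "(i, b)"] i by (simp add: \<sigma>_simps \<sigma>m X_iff)
    finally have "(prod w T * \<sigma> (prod w T) / m)\<^sup>2 = \<beta> (i, b) * \<beta> (i, \<not> b)"
      using m0 P2m by (simp add: power_mult_distrib power_divide power2_eq_square[of m])
    then have "(prod w T * \<sigma> (prod w T) / m)\<^sup>2 = of_nat (\<Prod>j\<in>{i}. t j * (t j - 1))"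
      using \<beta>_mult[OF i, of b] by simp
    moreover have "\<sigma> (prod w T) \<in> F"
      unfolding F_def
    proof (rule hom_on_gen_field_image[where \<phi> = \<sigma>])
      show "hom_on (gen_field (u ` {..<k})) \<sigma>" using \<sigma> by (simp add: F_def)
      show "prod w T \<in> gen_field (u ` {..<k})" using P by (simp add: F_def)
      fix a assume "a \<in> u ` {..<k}"
      then show "\<sigma> a \<in> gen_field (u ` {..<k})"
        using u_in_F subfield_uminus[OF subfield_F] by (auto simp: \<sigma>u simp flip: F_def)
    qed
    then have "prod w T * \<sigma> (prod w T) / m \<in> F"
      using P m by (intro subfield_divide subfield_mult subfield_F)
    ultimately show False using prod_mult_pred_not_square[of "{i}"] i by blast
  next
    case False
    define I where "I = fst ` T"
    have sym: "(i, c) \<in> T" if "(i, b) \<in> T" for i b c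
    proof -
      have "(i, \<not> b) \<in> T" using False that by blast
      then show ?thesis using that by (cases b; cases c) auto
    qed
    \<comment> \<open>Here \<open>T\<close> is a union of complete pairs, so its radicands multiply
      to the numbers \<open>t i * (t i - 1)\<close>.\<close>
    have TI: "T = I \<times> UNIV" unfolding I_def using sym by force
    have I: "I \<subseteq> {..<k}" "I \<noteq> {}" unfolding I_def using T by (auto simp: X_def)
    have "prod \<beta> T = (\<Prod>i\<in>I. \<Prod>b\<in>UNIV. \<beta> (i, b))"
      unfolding TI by (simp add: prod.cartesian_product)
    also have "\<dots> = of_nat (\<Prod>i\<in>I. t i * (t i - 1))"
      unfolding of_nat_prod
    proof (intro prod.cong refl)
      fix i assume "i \<in> I"
      then have "i < k" using I by blast
      then show "(\<Prod>b\<in>UNIV. \<beta> (i, b)) = of_nat (t i * (t i - 1))"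
        using \<beta>_mult[of i False] by (simp add: UNIV_bool)
    qed
    finally show False using prod_mult_pred_not_square[OF I P] P2 by simp
  qed
qed

text \<open>By Kummer theory over \<open>F\<close> a dependence would put a nonempty product of
  distinct \<open>w p\<close> into \<open>F\<close>.\<close>

lemma w_independent:
  assumes "p \<in> X"
  shows "w p \<notin> gen_field (u ` {..<k} \<union> w ` (X - {p}))"
proof
  assume mem: "w p \<in> gen_field (u ` {..<k} \<union> w ` (X - {p}))"
  have "\<exists>J\<subseteq>X - {p}. w p * prod w J \<in> gen_field (u ` {..<k})"
    using mem finite_X assms \<beta>_in_F by (intro quadratic_kummer) (auto simp: w_sq simp flip: F_def)
  then obtain J where J: "J \<subseteq> X - {p}" "w p * prod w J \<in> F" by (auto simp: F_def)
  moreover have "finite J" "p \<notin> J" using J finite_X finite_subset by blast+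
  ultimately show False using prod_w_notin_F[of "insert p J"] assms by auto
qed

lemma w_notin_gen_field: "p \<in> X \<Longrightarrow> w p \<notin> gen_field (w ` (X - {p}))"
  using w_independent[of p] gen_field_mono[of "w ` (X - {p})" "u ` {..<k} \<union> w ` (X - {p})"] by blast

section \<open>Sums of roots and their conjugates\<close>

lemma Q_iff: "i < k \<Longrightarrow> y \<in> Q i \<longleftrightarrow> (\<exists>b. y = w (i, b) \<or> y = - w (i, b))"
proof -
  assume i: "i < k"
  have "y \<in> Q i \<longleftrightarrow> (y\<^sup>2 - of_nat (t i))\<^sup>2 = (u i)\<^sup>2" using i by (simp add: Q_def u)
  also have "\<dots> \<longleftrightarrow> y\<^sup>2 - of_nat (t i) = u i \<or> y\<^sup>2 - of_nat (t i) = - u i"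
    by (rule power2_eq_iff)
  also have "\<dots> \<longleftrightarrow> (\<exists>b. y\<^sup>2 = (w (i, b))\<^sup>2)"
    using i by (auto simp: w ex_bool_eq algebra_simps)
  finally show ?thesis unfolding power2_eq_iff .
qed

lemma w_in_Q: "i < k \<Longrightarrow> w (i, b) \<in> Q i"
  by (auto simp: Q_iff)

lemma Q_subset_L: "i < k \<Longrightarrow> Q i \<subseteq> L"
  by (auto simp: Q_iff X_iff intro!: w_in_L subfield_uminus subfield_L)

lemma finite_R: "finite R"
proof -
  have "finite (Q i)" if "i < k" for i
    by (rule finite_subset[of _ "range (\<lambda>b. w (i, b)) \<union> range (\<lambda>b. - w (i, b))"])
       (auto simp: Q_iff that)
  then have "finite ((\<lambda>g. \<Sum>i<k. g i) ` (\<Pi>\<^sub>E i\<in>{..<k}. Q i))"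
    by (intro finite_imageI finite_PiE) auto
  moreover have "R \<subseteq> (\<lambda>g. \<Sum>i<k. g i) ` (\<Pi>\<^sub>E i\<in>{..<k}. Q i)"
  proof
    fix r assume "r \<in> R"
    then obtain g where "r = (\<Sum>i<k. g i)" "\<forall>i<k. g i \<in> Q i" by (auto simp: R_def)
    then show "r \<in> (\<lambda>g. \<Sum>i<k. g i) ` (\<Pi>\<^sub>E i\<in>{..<k}. Q i)"
      \<comment> \<open>The function \<open>g\<close> is arbitrary outside \<open>{..<k}\<close> and
        is restricted to become an element of the finite product.\<close>
      by (intro image_eqI[of _ _ "restrict g {..<k}"]) auto
  qed
  ultimately show ?thesis using finite_subset by blast
qed

lemma R_subset_L: "R \<subseteq> L"
  using Q_subset_L by (auto simp: R_def intro!: subfield_sum subfield_L)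

text \<open>The reason why a sum generates its summands. If \<open>g i\<close> is
  \<open>w (i, b)\<close> up to sign, then \<open>h i - g i\<close> lies in the field generated by
  the other \<open>w p\<close>. Either \<open>h i = - g i\<close>, or \<open>h i\<close> lies in
  that field itself; both put \<open>w (i, b)\<close> there, against independence.\<close>

lemma sum_Q_unique:
  assumes g: "\<And>i. i < k \<Longrightarrow> g i \<in> Q i" and h: "\<And>i. i < k \<Longrightarrow> h i \<in> Q i"
    and eq: "(\<Sum>i<k. g i) = (\<Sum>i<k. h i)" and i: "i < k"
  shows "g i = h i"
proof (rule ccontr)
  assume ne: "g i \<noteq> h i"
  obtain b where b: "g i = w (i, b) \<or> g i = - w (i, b)" using g[OF i] i Q_iff by blast
  obtain c where c: "h i = w (i, c) \<or> h i = - w (i, c)" using h[OF i] i Q_iff by blast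
  let ?E = "gen_field (w ` (X - {(i, b)}))"
  have E: "is_subfield ?E" by simp
  have wE: "w p \<in> ?E" if "p \<in> X" "p \<noteq> (i, b)" for p using that by (auto intro: gen_field_inc)
  have Q_E: "y \<in> ?E" if "y \<in> Q j" "j < k" "j \<noteq> i" for y j
    using that wE by (auto simp: Q_iff X_iff intro!: subfield_uminus)
  have "(\<Sum>j\<in>{..<k} - {i}. g j - h j) \<in> ?E"
    using g h by (intro subfield_sum subfield_diff) (auto intro!: Q_E)
  moreover have "h i - g i = (\<Sum>j\<in>{..<k} - {i}. g j - h j)"
    using eq i by (simp add: sum.remove[of "{..<k}" i] sum_subtractf algebra_simps)
  ultimately have d: "h i - g i \<in> ?E" by simp
  have "w (i, b) \<in> ?E"
  proof (cases "c = b")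
    case True
    then have "h i = - g i" using b c ne by auto
    then have "w (i, b) = (h i - g i) / 2 \<or> w (i, b) = - ((h i - g i) / 2)"
      using b by auto
    moreover have "(h i - g i) / 2 \<in> ?E" using d by (intro subfield_divide subfield_numeral) auto
    ultimately show ?thesis using subfield_uminus[OF E] by metis
  next
    case False
    then have "h i \<in> ?E" using c wE[of "(i, c)"] i by (auto simp: X_iff intro!: subfield_uminus)
    then have "g i \<in> ?E" using subfield_diff[OF E _ d, of "h i"] by simp
    then show ?thesis using b subfield_uminus[OF E, of "g i"] by auto
  qed
  then show False using w_notin_gen_field[of "(i, b)"] i by (simp add: X_iff)
qed

lemma hom_on_Q:
  assumes \<psi>: "hom_on L \<psi>" and "i < k" "y \<in> Q i"
  shows "\<psi> y \<in> Q i"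
proof -
  have "y \<in> L" using assms Q_subset_L by blast
  then have "((\<psi> y)\<^sup>2 - of_nat (t i))\<^sup>2 = \<psi> ((y\<^sup>2 - of_nat (t i))\<^sup>2)"
    by (simp add: hom_on_power[OF subfield_L \<psi>] hom_on_diff[OF subfield_L \<psi>]
        hom_on_of_nat[OF subfield_L \<psi>] subfield_closed subfield_L)
  then show ?thesis using assms(3) by (simp add: Q_def hom_on_of_nat[OF subfield_L \<psi>])
qed

lemma hom_on_sum_Q:
  assumes \<psi>: "hom_on L \<psi>" and "\<And>i. i < k \<Longrightarrow> g i \<in> Q i"
  shows "\<psi> (\<Sum>i<k. g i) = (\<Sum>i<k. \<psi> (g i))"
  using assms Q_subset_L by (intro hom_on_sum[OF subfield_L \<psi>]) auto

lemma hom_on_R: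
  assumes "hom_on L \<psi>" "r \<in> R"
  shows "\<psi> r \<in> R"
proof -
  obtain g where g: "r = (\<Sum>i<k. g i)" "\<And>i. i < k \<Longrightarrow> g i \<in> Q i"
    using assms(2) by (auto simp: R_def)
  then have "\<psi> r = (\<Sum>i<k. \<psi> (g i))" using hom_on_sum_Q[OF assms(1)] by simp
  then show ?thesis using hom_on_Q[OF assms(1) _ g(2)] unfolding R_def by blast
qed

text \<open>Transitivity on \<open>R\<close>. Sending \<open>u i\<close> to the square of
  \<open>g i\<close> minus \<open>t i\<close>, which is again a square root of \<open>t i\<close>,
  makes \<open>g i\<close> an admissible image of \<open>w (i, True)\<close>.\<close>

lemma hom_on_L_prescribed:
  assumes g: "\<And>i. i < k \<Longrightarrow> g i \<in> Q i"
  obtains \<psi> where "hom_on L \<psi>" "\<And>i. i < k \<Longrightarrow> \<psi> (w (i, True)) = g i"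
proof -
  have "\<exists>\<phi>. hom_on (gen_field ({} \<union> u ` {..<k})) \<phi> \<and> (\<forall>x\<in>gen_field {}. \<phi> x = x) \<and>
      (\<forall>i\<in>{..<k}. \<phi> (u i) = (g i)\<^sup>2 - of_nat (t i))"
    using u_independent g
    by (intro hom_on_extend_independent hom_on_id) (auto simp: u subfield_of_nat Q_def)
  then obtain \<phi> where \<phi>: "hom_on F \<phi>" and \<phi>u: "\<And>i. i < k \<Longrightarrow> \<phi> (u i) = (g i)\<^sup>2 - of_nat (t i)"
    by (auto simp: F_def)
  \<comment> \<open>No image is prescribed for \<open>w (i, False)\<close>; the principal square
    root serves as a default.\<close>
  define g' where "g' p = (if snd p then g (fst p) else csqrt (\<phi> ((w p)\<^sup>2)))" for p
  have "\<exists>\<psi>. hom_on (gen_field (u ` {..<k} \<union> w ` X)) \<psi> \<and> (\<forall>x\<in>gen_field (u ` {..<k}). \<psi> x = \<phi> x) \<and>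
      (\<forall>p\<in>X. \<psi> (w p) = g' p)"
  proof (rule hom_on_extend_independent[OF finite_X])
    show "hom_on (gen_field (u ` {..<k})) \<phi>" using \<phi> by (simp add: F_def)
    fix p assume p: "p \<in> X"
    show "(w p)\<^sup>2 \<in> gen_field (u ` {..<k})" using p \<beta>_in_F by (simp add: w_sq flip: F_def)
    show "w p \<notin> gen_field (u ` {..<k} \<union> w ` (X - {p}))" using w_independent[OF p] .
    show "(g' p)\<^sup>2 = \<phi> ((w p)\<^sup>2)"
    proof (cases p)
      case (Pair i b)
      then have i: "i < k" using p by (simp add: X_iff)
      have "\<phi> (of_nat (t i) + u i) = (g i)\<^sup>2"
        using i by (simp add: hom_on_add[OF \<phi>] hom_on_of_nat[OF subfield_F \<phi>] \<phi>u u_in_F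
            subfield_of_nat[OF subfield_F])
      then show ?thesis using Pair i by (cases b) (auto simp: g'_def w)
    qed
  qed
  then obtain \<psi> where \<psi>: "hom_on L \<psi>" "\<forall>p\<in>X. \<psi> (w p) = g' p"
    using gen_field_eq_L[of "{}"] by auto
  then have "\<psi> (w (i, True)) = g i" if "i < k" for i
    using that by (auto simp: X_iff g'_def)
  then show thesis using that \<psi> by blast
qed

text \<open>An element of \<open>L\<close> outside \<open>gen_field S\<close> would be moved by a
  homomorphism fixing \<open>S\<close>, but by rigidity such a homomorphism fixes all generators of
  \<open>L\<close>.\<close>

lemma gen_field_eq_L_if_rigid:
  assumes S: "S \<subseteq> L"
    and rigid: "\<And>\<psi> p. hom_on L \<psi> \<Longrightarrow> \<forall>s\<in>S. \<psi> s = s \<Longrightarrow> p \<in> X \<Longrightarrow> \<psi> (w p) = w p"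
  shows "gen_field S = L"
proof
  show "gen_field S \<subseteq> L" using S by (rule gen_field_minimal) (rule subfield_L)
  show "L \<subseteq> gen_field S"
  proof (rule subsetI, rule ccontr)
    fix x assume x: "x \<in> L" "x \<notin> gen_field S"
    have usq: "y\<^sup>2 \<in> gen_field S" if "y \<in> u ` {..<k}" for y
      using that by (auto simp: u intro!: subfield_of_nat)
    have F: "F \<subseteq> gen_field (S \<union> u ` {..<k})" unfolding F_def by (rule gen_field_mono) auto
    have wsq: "y\<^sup>2 \<in> gen_field (S \<union> u ` {..<k})" if y: "y \<in> w ` X" for y
    proof -
      obtain p where "p \<in> X" "y = w p" using y by blast
      then show ?thesis using \<beta>_in_F[of p] F by (auto simp: w_sq)
    qed
    obtain \<psi> where \<psi>: "hom_on L \<psi>" "\<forall>y\<in>gen_field S. \<psi> y = y" "\<psi> x \<noteq> x"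
    proof (rule hom_on_moving_two_steps[of "u ` {..<k}" "w ` X" S x])
      show "x \<in> gen_field (S \<union> u ` {..<k} \<union> w ` X)" using x by (simp add: gen_field_eq_L[OF S])
    qed (use usq wsq x finite_X gen_field_eq_L[OF S] in auto)
    have "\<forall>s\<in>S. \<psi> s = s" using \<psi>(2) gen_field_inc by blast
    then have "\<psi> y = y" if "y \<in> w ` X" for y
      using rigid[OF \<psi>(1)] that by blast
    then have "\<psi> x = x"
      using hom_on_gen_field_id[of "w ` X" \<psi> x] \<psi>(1) x(1) by (simp flip: L_def)
    then show False using \<psi>(3) by simp
  qed
qed

section \<open>Generating sets consisting of sums\<close>

text \<open>The sums of $a_i$'s and $b_i$'s: \<open>c i\<close> decides between them at the index
  \<open>i\<close>.\<close>

definition \<alpha> :: "(nat \<Rightarrow> bool) \<Rightarrow> complex" where "\<alpha> c = (\<Sum>i<k. w (i, c i))"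

lemma \<alpha>_in_R: "\<alpha> c \<in> R"
  using w_in_Q by (auto simp: \<alpha>_def R_def)

lemma \<alpha>_in_gen_field: "(\<And>i. i < k \<Longrightarrow> (i, c i) \<noteq> p) \<Longrightarrow> \<alpha> c \<in> gen_field (w ` (X - {p}))"
  unfolding \<alpha>_def by (intro subfield_sum) (auto simp: X_iff intro!: gen_field_inc)

text \<open>\<open>\<psi>\<close> keeps each summand in its own \<open>Q i\<close>, so fixing the
  sum gives two decompositions of the same number, which agree by
  \<open>sum_Q_unique\<close>.\<close>

lemma hom_on_\<alpha>_fixed:
  assumes "hom_on L \<psi>" "\<psi> (\<alpha> c) = \<alpha> c" "i < k"
  shows "\<psi> (w (i, c i)) = w (i, c i)"
  using assms hom_on_Q[OF assms(1)] hom_on_sum_Q[OF assms(1), of "\<lambda>i. w (i, c i)"] w_in_Q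
  by (intro sum_Q_unique[of "\<lambda>i. \<psi> (w (i, c i))" "\<lambda>i. w (i, c i)"]) (auto simp: \<alpha>_def)

lemma w_inj: "i < k \<Longrightarrow> w (i, True) \<noteq> w (i, False)"
  using w_notin_gen_field[of "(i, True)"] gen_field_inc[of "w (i, False)" "w ` (X - {(i, True)})"]
  by (auto simp: X_iff)

lemma \<alpha>_eq: "\<alpha> c = \<alpha> d \<Longrightarrow> i < k \<Longrightarrow> c i = d i"
proof -
  assume "\<alpha> c = \<alpha> d" "i < k"
  then have "w (i, c i) = w (i, d i)"
    using w_in_Q sum_Q_unique[of "\<lambda>i. w (i, c i)" "\<lambda>i. w (i, d i)" i] by (auto simp: \<alpha>_def)
  then show ?thesis using w_inj[OF \<open>i < k\<close>] by (cases "c i"; cases "d i") auto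
qed

text \<open>The orbit criterion with the sum of all $a_i$ as base point: moving homomorphisms over
  the rationals give the fixed field, and prescribed images give transitivity.\<close>

lemma exists_poly:
  obtains f where "irreducible f" "lead_coeff f = 1" "roots_of f = R"
proof (rule irreducible_poly_of_orbit[OF subfield_L finite_R R_subset_L \<alpha>_in_R[of "\<lambda>_. True"]])
  fix x assume x: "x \<in> L" and fixed: "\<And>\<psi>. hom_on L \<psi> \<Longrightarrow> \<psi> x = x"
  show "x \<in> \<rat>"
  proof (rule ccontr)
    assume "x \<notin> \<rat>"
    obtain \<psi> where "hom_on L \<psi>" "\<psi> x \<noteq> x"
    proof (rule hom_on_moving_two_steps[of "u ` {..<k}" "w ` X" "{}" x])
      show "x \<in> gen_field ({} \<union> u ` {..<k} \<union> w ` X)" using x by (simp only: gen_field_eq_L[of "{}"] empty_subsetI)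
      show "x \<notin> gen_field {}" using \<open>x \<notin> \<rat>\<close> by (simp add: gen_field_empty)
      show "y\<^sup>2 \<in> gen_field {}" if "y \<in> u ` {..<k}" for y
        using that by (auto simp: u intro!: subfield_of_nat)
      show "y\<^sup>2 \<in> gen_field ({} \<union> u ` {..<k})" if "y \<in> w ` X" for y
        using that \<beta>_in_F by (auto simp: w_sq simp flip: F_def)
    qed (use finite_X gen_field_eq_L[of "{}"] in auto)
    then show False using fixed by blast
  qed
next
  fix r assume "r \<in> R"
  then obtain g where g: "r = (\<Sum>i<k. g i)" "\<And>i. i < k \<Longrightarrow> g i \<in> Q i" by (auto simp: R_def)
  obtain \<psi> where \<psi>: "hom_on L \<psi>" "\<And>i. i < k \<Longrightarrow> \<psi> (w (i, True)) = g i"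
    using hom_on_L_prescribed[OF g(2)] by blast
  then have "\<psi> (\<alpha> (\<lambda>_. True)) = r"
    unfolding \<alpha>_def g(1) using hom_on_sum_Q[OF \<psi>(1), of "\<lambda>i. w (i, True)"] w_in_Q by simp
  then show "\<exists>\<psi>. hom_on L \<psi> \<and> \<psi> (\<alpha> (\<lambda>_. True)) = r" using \<psi>(1) by blast
qed (use hom_on_R that in blast)+

text \<open>By \<open>cover\<close> every \<open>w p\<close> is a summand of some sum, so a
  homomorphism fixing the sums fixes \<open>L\<close>. By \<open>needed\<close> some
  \<open>w (i, c i)\<close> occurs in no sum but \<open>\<alpha> c\<close>, so omitting
  \<open>\<alpha> c\<close> leaves a field without it.\<close>

lemma minimal_generating_set_\<alpha>:
  assumes f: "roots_of f = R"
    and cover: "\<And>i b. i < k \<Longrightarrow> \<exists>c\<in>C. c i = b"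
    and needed: "\<And>c. c \<in> C \<Longrightarrow> \<exists>i<k. \<forall>d\<in>C - {c}. d i \<noteq> c i"
  shows "minimal_generating_set f (\<alpha> ` C)"
proof -
  \<comment> \<open>Stated for all sets \<open>S\<close> in between, because it is applied both to
    the sums themselves and to the full root set \<open>R\<close>.\<close>
  have gen: "gen_field S = L" if S: "\<alpha> ` C \<subseteq> S" "S \<subseteq> L" for S
  proof (rule gen_field_eq_L_if_rigid[OF S(2)])
    fix \<psi> p assume \<psi>: "hom_on L \<psi>" "\<forall>s\<in>S. \<psi> s = s" and p: "p \<in> X"
    obtain i b where ib: "p = (i, b)" by (cases p)
    then have i: "i < k" using p by (simp add: X_iff)
    then obtain c where c: "c \<in> C" "c i = b" using cover by blast
    then have "\<psi> (\<alpha> c) = \<alpha> c" using \<psi>(2) S by blast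
    then show "\<psi> (w p) = w p" using hom_on_\<alpha>_fixed[OF \<psi>(1) _ i] c ib by blast
  qed
  have sub: "\<alpha> ` C \<subseteq> R" using \<alpha>_in_R by blast
  have split: "splitting_field f = L"
    unfolding splitting_field_def rat_adjoin_eq_gen_field f using gen sub R_subset_L by blast
  have "gen_field A \<noteq> L" if A: "A \<subset> \<alpha> ` C" for A
  proof -
    obtain c where c: "c \<in> C" "\<alpha> c \<notin> A" using A by blast
    obtain i where i: "i < k" "\<forall>d\<in>C - {c}. d i \<noteq> c i" using needed[OF c(1)] by blast
    have "A \<subseteq> gen_field (w ` (X - {(i, c i)}))"
    proof
      fix a assume "a \<in> A"
      then obtain d where d: "d \<in> C - {c}" "a = \<alpha> d" using A c by blast
      then have "(j, d j) \<noteq> (i, c i)" for j using i(2) by blast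
      then show "a \<in> gen_field (w ` (X - {(i, c i)}))" using \<alpha>_in_gen_field d(2) by blast
    qed
    then have "gen_field A \<subseteq> gen_field (w ` (X - {(i, c i)}))" by (rule gen_field_minimal) simp
    moreover have "w (i, c i) \<in> L" "w (i, c i) \<notin> gen_field (w ` (X - {(i, c i)}))"
      using w_in_L w_notin_gen_field i by (simp_all add: X_iff)
    ultimately show ?thesis by blast
  qed
  then show ?thesis
    unfolding minimal_generating_set_def rat_adjoin_eq_gen_field split f
    using gen[of "\<alpha> ` C"] sub R_subset_L by auto
qed

lemma exists_mingen_poly:
  assumes "k > 1"
  shows "mingen_polys k \<noteq> {}"
proof -
  obtain f where f: "irreducible f" "lead_coeff f = 1" "roots_of f = R" using exists_poly .
  \<comment> \<open>\<open>?B\<close> gives the sum of all $a_i$ and that of all $b_i$; the member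
    of \<open>?C\<close> with index \<open>j\<close> has its only $b$ at \<open>j\<close>.\<close>
  let ?B = "{\<lambda>_. True, \<lambda>_. False}" and ?C = "(\<lambda>j i. i \<noteq> j) ` {..<k}"
  have "minimal_generating_set f (\<alpha> ` ?B)"
    using assms by (intro minimal_generating_set_\<alpha>[OF f(3)]) (auto intro!: exI[of _ 0])
  moreover have "minimal_generating_set f (\<alpha> ` ?C)"
  proof (intro minimal_generating_set_\<alpha>[OF f(3)])
    fix i :: nat and b assume i: "i < k"
    have "\<exists>j<k. (i \<noteq> j) = b"
    proof (cases b)
      case True
      \<comment> \<open>To obtain $a_i$, the single replacement must happen at some other index, and
        \<open>k > 1\<close> provides one.\<close>
      then show ?thesis using i assms by (intro exI[of _ "if i = 0 then 1 else 0"]) auto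
    qed (use i in auto)
    then show "\<exists>c\<in>?C. c i = b" by auto
  next
    fix c assume "c \<in> ?C"
    \<comment> \<open>The witness for the member with index \<open>j\<close> is \<open>j\<close>
      itself, where all the others take the value \<open>True\<close>.\<close>
    then show "\<exists>i<k. \<forall>d\<in>?C - {c}. d i \<noteq> c i" by auto
  qed
  moreover have "\<alpha> (\<lambda>_. True) \<noteq> \<alpha> (\<lambda>_. False)" using \<alpha>_eq[of "\<lambda>_. True" "\<lambda>_. False" 0] assms by auto
  then have "card (\<alpha> ` ?B) = 2" by simp
  moreover have "inj_on (\<lambda>j. \<alpha> (\<lambda>i. i \<noteq> j)) {..<k}"
  proof (rule inj_onI)
    fix j j' assume "j \<in> {..<k}" "\<alpha> (\<lambda>i. i \<noteq> j) = \<alpha> (\<lambda>i. i \<noteq> j')"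
    then show "j = j'" using \<alpha>_eq[of "\<lambda>i. i \<noteq> j" "\<lambda>i. i \<noteq> j'" j] by auto
  qed
  then have "card (\<alpha> ` ?C) = k" by (simp add: image_image card_image)
  ultimately show ?thesis using f unfolding mingen_polys_def by blast
qed

end

section \<open>Choice of the radicands\<close>

text \<open>\<open>q\<close> is an algebraic integer because its square is an integer, and a
  rational algebraic integer is an integer.\<close>

lemma rational_sqrt_of_nat:
  assumes "q \<in> \<rat>" "(q :: complex)\<^sup>2 = of_nat N"
  obtains m where "N = m\<^sup>2"
proof -
  have "algebraic_int q"
  proof (rule algebraic_int_root)
    show "poly (monom 1 2) q = of_nat N" using assms(2) by (simp add: poly_monom)
  qed (auto simp: degree_monom_eq coeff_monom)
  then have "q \<in> \<int>" using assms(1) by (rule rational_algebraic_int_is_int)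
  then obtain a where "q = of_int a" by (rule Ints_cases)
  then have "(of_int (a\<^sup>2) :: complex) = of_int (int N)" using assms(2) by simp
  then have "int N = a\<^sup>2" by (simp only: of_int_eq_iff)
  then have "N = (nat \<bar>a\<bar>)\<^sup>2" by (metis nat_int nat_power_eq abs_ge_zero power2_abs)
  then show thesis using that by blast
qed

text \<open>The prime divides the product exactly once, but a square that it divides is divisible by
  its square.\<close>

lemma not_square_if_exactly_divides:
  fixes a b p :: nat
  assumes p: "prime p" and "p dvd a" "\<not> p\<^sup>2 dvd a" "\<not> p dvd b"
  shows "a * b \<noteq> m\<^sup>2"
proof
  assume m: "a * b = m\<^sup>2"
  then have "p dvd m\<^sup>2" using assms(2) by (metis dvd_mult2)
  then have "p\<^sup>2 dvd a * b" using p m by (simp add: prime_dvd_power_iff dvd_power_same)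
  moreover have "coprime (p\<^sup>2) b" using p assms(4) by (simp add: prime_imp_coprime)
  ultimately show False using assms(3) by (simp add: coprime_dvd_mult_left_iff)
qed

text \<open>Each of the numbers \<open>t i\<close> and \<open>t i - 1\<close> gets a private prime dividing it exactly once,
  with indices \<open>2 * i\<close> and \<open>2 * i + 1\<close> respectively.\<close>

lemma exists_independent_radicands:
  obtains t :: "nat \<Rightarrow> nat" where "\<And>i. i < k \<Longrightarrow> t i \<ge> 2"
    and "\<And>I J q. \<lbrakk>I \<subseteq> {..<k}; J \<subseteq> {..<k}; q \<in> \<rat>;
      (q :: complex)\<^sup>2 = of_nat ((\<Prod>i\<in>I. t i * (t i - 1)) * (\<Prod>j\<in>J. t j))\<rbrakk> \<Longrightarrow> I = {} \<and> J = {}"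
proof -
  \<comment> \<open>The prime 2 is left out because 2 serves below as a residue that must be a
    unit.\<close>
  have "infinite ({p::nat. prime p} - {..2})" using primes_infinite by (simp add: Diff_infinite_finite)
  then obtain p :: "nat \<Rightarrow> nat" where inj: "inj p" and "range p \<subseteq> {p. prime p} - {..2}"
    using infinite_countable_subset by blast
  have p: "prime (p j)" "p j > 2" for j
  proof -
    have "p j \<in> {p. prime p} - {..2}" using \<open>range p \<subseteq> _\<close> by blast
    then show "prime (p j)" "p j > 2" by auto
  qed
  have p2: "\<not> (p j)\<^sup>2 dvd p j" for j
    using p(2)[of j] by (auto simp: power2_eq_square dest!: dvd_imp_le)
  \<comment> \<open>Residues modulo the squares of the primes: \<open>p j\<close> makes
    \<open>t i\<close> divisible exactly once, \<open>1 + p j\<close> does the same for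
    \<open>t i - 1\<close>, and 2 keeps both prime to \<open>p j\<close>.\<close>
  define v where "v i j = (if j = 2 * i then p j else if j = 2 * i + 1 then 1 + p j else 2)" for i j
  have "\<exists>x. \<forall>j\<in>{..<2 * k}. [x = v i j] (mod (p j)\<^sup>2)" for i
    using p inj by (intro chinese_remainder_nat) (auto simp: primes_coprime inj_eq)
  then obtain t where t: "\<And>i j. j < 2 * k \<Longrightarrow> [t i = v i j] (mod (p j)\<^sup>2)"
    by (metis lessThan_iff)
  have tp: "[t i = v i j] (mod p j)" if "j < 2 * k" for i j
    using t[OF that] by (rule cong_dvd_modulus_nat) simp
  have ndvd1: "\<not> p j dvd Suc 0" "\<not> p j dvd 2" for j
    using p[of j] by (auto dest: dvd_imp_le)
  have ndvd_Suc: "\<not> p j dvd Suc (p j)" for j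
    using ndvd1(1)[of j] dvd_add_right_iff[of "p j" "p j" 1] by simp
  have t_dvd: "p j dvd t i \<longleftrightarrow> j = 2 * i" if "j < 2 * k" for i j
    using cong_dvd_iff[OF tp[OF that]] ndvd1[of j] ndvd_Suc[of j] by (auto simp: v_def)
  have t_sq: "\<not> (p (2 * i))\<^sup>2 dvd t i" if "i < k" for i
    using cong_dvd_iff[OF t[of "2 * i" i]] that p2[of "2 * i"] by (simp add: v_def)
  have t2: "t i \<ge> 2" if "i < k" for i
  proof -
    have "\<not> p (2 * i + 1) dvd t i" using t_dvd[of "2 * i + 1" i] that by simp
    then have "t i \<noteq> 0" by (metis dvd_0_right)
    moreover have "t i \<noteq> 1" using t_dvd[of "2 * i" i] that ndvd1 by auto
    ultimately show ?thesis by simp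
  qed
  \<comment> \<open>Subtraction on natural numbers is truncated, so both sides must be at least
    1.\<close>
  have pred: "[t i - 1 = v i j - 1] (mod m)" if "[t i = v i j] (mod m)" "i < k" for i j m
  proof -
    have "v i j \<ge> 1" using p(2)[of j] by (auto simp: v_def)
    then show ?thesis using that t2[of i] by (intro cong_diff_nat) auto
  qed
  have s_dvd: "p j dvd t i - 1 \<longleftrightarrow> j = 2 * i + 1" if "i < k" "j < 2 * k" for i j
  proof -
    have "\<not> p j dvd p j - 1" using p(2)[of j] by (auto dest!: dvd_imp_le)
    then show ?thesis
      using cong_dvd_iff[OF pred[OF tp[OF that(2)] that(1)]] ndvd1[of j] by (auto simp: v_def)
  qed
  have s_sq: "\<not> (p (2 * i + 1))\<^sup>2 dvd t i - 1" if "i < k" for i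
    using cong_dvd_iff[OF pred[OF t[of "2 * i + 1" i] that]] that p2[of "2 * i + 1"]
    by (simp add: v_def)
  have "I = {} \<and> J = {}"
    if I: "I \<subseteq> {..<k}" and J: "J \<subseteq> {..<k}" and q: "q \<in> \<rat>"
      "(q :: complex)\<^sup>2 = of_nat ((\<Prod>i\<in>I. t i * (t i - 1)) * (\<Prod>j\<in>J. t j))" for I J q
  proof -
    obtain m where m: "(\<Prod>i\<in>I. t i * (t i - 1)) * (\<Prod>j\<in>J. t j) = m\<^sup>2"
      using rational_sqrt_of_nat[OF q] .
    have fin: "finite I" "finite J" using I J finite_subset by blast+
    \<comment> \<open>\<open>I\<close> is treated first: the numbers \<open>t i - 1\<close> occur
      only in its product, so a prime of odd index divides exactly one factor. Then only the product
      over \<open>J\<close> remains, and the primes of even index settle it.\<close>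
    have "I = {}"
    proof (rule ccontr)
      assume "I \<noteq> {}"
      then obtain i where i: "i \<in> I" by blast
      then have ik: "i < k" "2 * i + 1 < 2 * k" using I by auto
      let ?p = "p (2 * i + 1)"
      let ?b = "t i * (\<Prod>i\<in>I - {i}. t i * (t i - 1)) * (\<Prod>j\<in>J. t j)"
      have "2 * i + 1 \<noteq> 2 * j" for j by presburger
      then have "\<not> ?p dvd t j" for j using t_dvd[OF ik(2), of j] by blast
      moreover have "\<not> ?p dvd t j - 1" if "j \<in> I - {i}" for j
        using s_dvd[OF _ ik(2), of j] that I by auto
      ultimately have "\<not> ?p dvd ?b"
        using p(1)[of "2 * i + 1"] fin by (auto simp: prime_dvd_mult_iff prime_dvd_prod_iff)
      then have "(t i - 1) * ?b \<noteq> m\<^sup>2"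
        using ik s_dvd[OF ik] s_sq by (intro not_square_if_exactly_divides[OF p(1)]) auto
      then show False using m fin i by (simp add: prod.remove[of I i] mult_ac)
    qed
    moreover have "J = {}"
    proof (rule ccontr)
      assume "J \<noteq> {}"
      then obtain i where i: "i \<in> J" by blast
      then have ik: "i < k" "2 * i < 2 * k" using J by auto
      have "\<not> p (2 * i) dvd t j" if "j \<noteq> i" for j using t_dvd[OF ik(2), of j] that by simp
      then have "\<not> p (2 * i) dvd (\<Prod>j\<in>J - {i}. t j)"
        using p(1)[of "2 * i"] fin by (auto simp: prime_dvd_prod_iff)
      then have "t i * (\<Prod>j\<in>J - {i}. t j) \<noteq> m\<^sup>2"
        using ik t_dvd[OF ik(2)] t_sq by (intro not_square_if_exactly_divides[OF p(1)]) auto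
      then show False using m fin i \<open>I = {}\<close> by (simp add: prod.remove[of J i])
    qed
    ultimately show ?thesis by simp
  qed
  then show thesis using that t2 by blast
qed

theorem proposition2p5:
  fixes k :: nat
  assumes "k > 2"
  shows "infinite (mingen_polys k) \<and> (\<exists>n. infinite {f \<in> mingen_polys k. degree f = n})"
proof -
  obtain t :: "nat \<Rightarrow> nat" where t: "\<And>i. i < k \<Longrightarrow> t i \<ge> 2"
    and indep: "\<And>I J q. \<lbrakk>I \<subseteq> {..<k}; J \<subseteq> {..<k}; q \<in> \<rat>;
      (q :: complex)\<^sup>2 = of_nat ((\<Prod>i\<in>I. t i * (t i - 1)) * (\<Prod>j\<in>J. t j))\<rbrakk> \<Longrightarrow> I = {} \<and> J = {}"
    using exists_independent_radicands[of k] by metis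
  \<comment> \<open>The locale prescribes only the squares, so principal square roots serve.\<close>
  define u where "u i = csqrt (of_nat (t i))" for i
  define w where "w p = csqrt (of_nat (t (fst p)) + (if snd p then u (fst p) else - u (fst p)))"
    for p :: "nat \<times> bool"
  interpret independent_quartics k t u w
  proof
    show "(u i)\<^sup>2 = of_nat (t i)" for i unfolding u_def by (rule power2_csqrt)
    show "(w (i, b))\<^sup>2 = of_nat (t i) + (if b then u i else - u i)" for i b
      unfolding w_def fst_conv snd_conv by (rule power2_csqrt)
  qed (fact t indep)+
  obtain f where "f \<in> mingen_polys k" using exists_mingen_poly assms by auto
  then have "infinite {g \<in> mingen_polys k. degree g = degree f}"
    by (rule infinite_mingen_polys_same_degree)
  moreover from this have "infinite (mingen_polys k)"
    by (rule contrapos_nn) auto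
  ultimately show ?thesis by blast
qed

end
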